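(* Let $k,m$ be non-zero integers with $k\neq\pm m$ and consider the functions $v_\pm,r_\pm$ on $\mathbb{CP}^3\setminus\mathcal S$ associated with $\xi=\mathrm{diag}(ik,im)\in\mathfrak{sp}(2)$. Let $M_F$ be the quotient of $\mathbb{CP}^3\setminus\mathcal S$ by $\mathbb{T}^2$. The map $$p=(v_+,v_-,r_+,r_-)\colon M_F\to\mathbb{R}^4$$ maps to a bounded set $D\subset\mathbb{R}^4$ (its image) over which $p$ is a branched double cover. The two different points in the fibres of $p$ are complex conjugates of each other, i.e. interchanged by the map induced by $\delta[Z_0,Z_1,Z_2,Z_3]=[\overline{Z_0},\overline{Z_1},\overline{Z_2},\overline{Z_3}]$, and the branch locus is equal to $\mathcal B=\nu^{-1}(0)$ (i.e. to its image in $M_F$).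
   Context: Identify $\mathbb{H}=\mathbb{C}\oplus j\mathbb{C}$ and $\mathbb{H}^2\cong\mathbb{C}^4$ via $(Z_0+jZ_1,Z_2+jZ_3)\leftrightarrow(Z_0,Z_1,Z_2,Z_3)$, so that $\mathrm{Sp}(2)$ acts on $\mathbb{CP}^3=\mathrm{Sp}(2)/(S^1\times S^3)$, where $S^1\times S^3=\{\mathrm{diag}(z,q)\}$ is the stabiliser of $[1,0,0,0]$. For $q=z+jw\in\mathbb{H}$ write $q_{\mathbb C}=z$, $q_{j\mathbb C}=w$. $\mathbb{T}^2=\{\mathrm{diag}(e^{i\theta},e^{i\phi})\}\subset\mathrm{Sp}(2)$ acts on $\mathbb{CP}^3$ by $[e^{i\theta}Z_0,e^{-i\theta}Z_1,e^{i\phi}Z_2,e^{-i\phi}Z_3]$. $\mathcal S$ is the union of the six projective lines $\{Z_a=Z_b=0\}$, $0\le a<b\le3$; it is the set where $\mathbb{T}^2$ (modulo $\pm1$) does not act freely. For $x=g[1,0,0,0]\in\mathbb{CP}^3\setminus\mathcal S$, $g\in\mathrm{Sp}(2)$, write $g^{-1}\xi g=\begin{pmatrix} q_1 & -\overline{q_2} \\ q_2 & q_3 \end{pmatrix}$; then $q_2\ne0$. Put $Q_3=q_2^{-1}q_3q_2$ and $$v_-=|(q_1)_{j\mathbb C}|^2,\quad r_-=2i(q_1)_{\mathbb C},\quad v_+=|(Q_3)_{j\mathbb C}|^2,\quad r_+=-2i(Q_3)_{\mathbb C}.$$ These are independent of the choice of $g$, $\mathbb{T}^2$-invariant and real-valued.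 (Geometrically, with $K^\xi$ the Killing field of $\xi$ and $J$ the nearly Kähler almost complex structure: $v_-$ is the squared norm of the vertical part of $K^\xi$ for the twistor fibration $\mathbb{CP}^3\to S^4$, $v_+=|\tau(K^\xi)|^2$ for the component $\tau$ of the Maurer–Cartan form in an adapted frame, and $r_\pm=\frac12JK^\xi(\log v_\pm)$ where $v_\pm>0$.) $\nu=\omega(K^{\xi_1},K^{\xi_2})$ is the nearly Kähler multi-moment map of the $\mathbb{T}^2$-action ($\omega$ the nearly Kähler 2-form, $\xi_1=\mathrm{diag}(i,0)$, $\xi_2=\mathrm{diag}(0,i)$); explicitly $\nu=\frac{12}{|Z|^4}\mathrm{Im}(Z_0Z_1\overline{Z_2}\,\overline{Z_3})$. A branched double cover here means a continuous surjection onto $D$ whose fibres have two points away from the branch locus and one point on it, the restriction to the complement of the branch locus being a double covering onto its image. *)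

theory Defs
  imports "HOL-Analysis.Analysis"
begin

section \<open>Quaternions\<close>

text \<open>\<open>Quat z w\<close> is the quaternion \<open>z + jw\<close>. Since \<open>zj = j(cnj z)\<close>, the product is
  \<open>(z + jw)(z' + jw') = (zz' - (cnj w)w') + j((cnj z)w' + wz')\<close>, and the conjugate of
  \<open>z + jw\<close> is \<open>cnj z - jw\<close>.\<close>

datatype quat = Quat (qC: complex) (qJ: complex)

definition qcnj :: "quat \<Rightarrow> quat" where
  "qcnj q = Quat (cnj (qC q)) (- qJ q)"

definition qnorm2 :: "quat \<Rightarrow> real" where
  "qnorm2 q = (cmod (qC q))\<^sup>2 + (cmod (qJ q))\<^sup>2"

instantiation quat :: division_ring
begin

definition "0 = Quat 0 0"
definition "1 = Quat 1 0"
definition "p + q = Quat (qC p + qC q) (qJ p + qJ q)"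
definition "p - q = Quat (qC p - qC q) (qJ p - qJ q)"
definition "- q = Quat (- qC q) (- qJ q)"
definition "p * q = Quat (qC p * qC q - cnj (qJ p) * qJ q) (cnj (qC p) * qJ q + qJ p * qC q)"
definition "inverse q = Quat (cnj (qC q) / of_real (qnorm2 q)) (- qJ q / of_real (qnorm2 q))"
definition "p div q = p * inverse q" for p q :: quat

instance
proof
  have n: "of_real (qnorm2 q) = cnj (qC q) * qC q + cnj (qJ q) * qJ q" for q
    by (simp only: qnorm2_def of_real_add complex_norm_square mult.commute)
  have nz: "of_real (qnorm2 q) \<noteq> (0::complex)" if "q \<noteq> 0" for q
    using that unfolding of_real_eq_0_iff
    by (cases q) (auto simp: qnorm2_def zero_quat_def sum_power2_eq_zero_iff)
  fix a b c :: quat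
  show "a * b * c = a * (b * c)" by (simp add: times_quat_def algebra_simps)
  show "1 * a = a" "a * 1 = a" by (simp_all add: times_quat_def one_quat_def)
  show "(a + b) * c = a * c + b * c" "a * (b + c) = a * b + a * c"
    by (simp_all add: times_quat_def plus_quat_def algebra_simps)
  show "(0::quat) \<noteq> 1" by (simp add: zero_quat_def one_quat_def)
  show "inverse (0::quat) = 0" by (simp add: zero_quat_def inverse_quat_def)
  show "a div b = a * inverse b" by (simp add: divide_quat_def)
  show "inverse a * a = 1" "a * inverse a = 1" if "a \<noteq> 0"
    using nz[OF that] n[of a]
    by (simp_all add: times_quat_def inverse_quat_def one_quat_def add_divide_distrib[symmetric]
        mult.commute)
qed (simp_all add: zero_quat_def plus_quat_def minus_quat_def uminus_quat_def)

end

section \<open>\<open>Sp(2)\<close> and its action on complex projective 3-space\<close>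

definition adjoint_mat :: "quat^2^2 \<Rightarrow> quat^2^2" where
  "adjoint_mat A = (\<chi> a b. qcnj (A $ b $ a))"

definition Sp2 :: "(quat^2^2) set" where
  "Sp2 = {g. g ** adjoint_mat g = mat 1 \<and> adjoint_mat g ** g = mat 1}"

definition diag2 :: "quat \<Rightarrow> quat \<Rightarrow> quat^2^2" where
  "diag2 q r = vector [vector [q, 0], vector [0, r]]"

text \<open>The homogeneous coordinates \<open>Z\<^sub>0, \<dots>, Z\<^sub>3\<close> are \<open>Z $ 0, \<dots>, Z $ 3\<close>;
  the numerals \<open>0, 1, 2, 3\<close> are the four elements of the index type \<open>4\<close>.\<close>

definition hvec :: "complex^4 \<Rightarrow> quat^2" where
  "hvec Z = vector [Quat (Z $ 0) (Z $ 1), Quat (Z $ 2) (Z $ 3)]"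

text \<open>A point \<open>[Z]\<close> of projective space is the set of all non-zero multiples of \<open>Z\<close>.\<close>

definition cls :: "complex^4 \<Rightarrow> (complex^4) set" where
  "cls Z = {c *s Z | c. c \<noteq> 0}"

definition quotient_topology :: "'a topology \<Rightarrow> ('a \<Rightarrow> 'b) \<Rightarrow> 'b topology" where
  "quotient_topology X f =
     topology (\<lambda>U. U \<subseteq> f ` topspace X \<and> openin X {x \<in> topspace X. f x \<in> U})"

lemma openin_quotient_topology:
  "openin (quotient_topology X f) U \<longleftrightarrow>
     U \<subseteq> f ` topspace X \<and> openin X {x \<in> topspace X. f x \<in> U}"
proof -
  have "istopology (\<lambda>U. U \<subseteq> f ` topspace X \<and> openin X {x \<in> topspace X. f x \<in> U})"
    unfolding istopology_def
  proof (intro conjI allI impI)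
    fix S T
    assume S: "S \<subseteq> f ` topspace X \<and> openin X {x \<in> topspace X. f x \<in> S}"
      and T: "T \<subseteq> f ` topspace X \<and> openin X {x \<in> topspace X. f x \<in> T}"
    show "S \<inter> T \<subseteq> f ` topspace X"
      using S by blast
    have "{x \<in> topspace X. f x \<in> S \<inter> T} =
        {x \<in> topspace X. f x \<in> S} \<inter> {x \<in> topspace X. f x \<in> T}" by blast
    then show "openin X {x \<in> topspace X. f x \<in> S \<inter> T}"
      using S T by (simp only: openin_Int)
  next
    fix \<K>
    assume *: "\<forall>K\<in>\<K>. K \<subseteq> f ` topspace X \<and> openin X {x \<in> topspace X. f x \<in> K}"
    then show "\<Union>\<K> \<subseteq> f ` topspace X" by blast
    have "{x \<in> topspace X. f x \<in> \<Union>\<K>} = (\<Union>K\<in>\<K>. {x \<in> topspace X. f x \<in> K})" by blast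
    moreover have "openin X (\<Union>K\<in>\<K>. {x \<in> topspace X. f x \<in> K})"
      using * by (intro openin_Union) blast
    ultimately show "openin X {x \<in> topspace X. f x \<in> \<Union>\<K>}" by (simp only:)
  qed
  then show ?thesis
    unfolding quotient_topology_def by (rule fun_cong[OF topology_inverse'])
qed

lemma topspace_quotient_topology: "topspace (quotient_topology X f) = f ` topspace X"
proof
  show "topspace (quotient_topology X f) \<subseteq> f ` topspace X"
    using openin_topspace[of "quotient_topology X f"]
    unfolding openin_quotient_topology by (rule conjunct1)
  have "{x \<in> topspace X. f x \<in> f ` topspace X} = topspace X" by blast
  then show "f ` topspace X \<subseteq> topspace (quotient_topology X f)"
    by (intro openin_subset) (simp add: openin_quotient_topology)
qed

lemma quotient_map_quotient_topology: "quotient_map X (quotient_topology X f) f"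
  unfolding quotient_map_def openin_quotient_topology topspace_quotient_topology by blast

definition CP3 :: "(complex^4) set topology" where
  "CP3 = quotient_topology (top_of_set (- {0})) cls"

definition cp_act :: "quat^2^2 \<Rightarrow> (complex^4) set \<Rightarrow> (complex^4) set" where
  "cp_act g x = {W. \<exists>Z\<in>x. hvec W = g *v hvec Z}"

definition base_pt :: "(complex^4) set" where
  "base_pt = cls (axis 0 1)"

definition T2 :: "(quat^2^2) set" where
  "T2 = {diag2 (Quat (cis \<theta>) 0) (Quat (cis \<phi>) 0) | \<theta> \<phi>. True}"

definition sing_lines :: "(complex^4) set set" where
  "sing_lines = {cls Z | Z. Z \<noteq> 0 \<and> (\<exists>a b. a \<noteq> b \<and> Z $ a = 0 \<and> Z $ b = 0)}"

definition orb :: "(complex^4) set \<Rightarrow> (complex^4) set set" where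
  "orb x = {cp_act t x | t. t \<in> T2}"

definition M_F :: "(complex^4) set set topology" where
  "M_F = quotient_topology (subtopology CP3 (topspace CP3 - sing_lines)) orb"

definition delta :: "(complex^4) set \<Rightarrow> (complex^4) set" where
  "delta x = (\<lambda>Z. \<chi> a. cnj (Z $ a)) ` x"

definition delta_F :: "(complex^4) set set \<Rightarrow> (complex^4) set set" where
  "delta_F X = delta ` X"

section \<open>The functions \<open>v\<^sub>\<plusminus>\<close>, \<open>r\<^sub>\<plusminus>\<close> and \<open>\<nu>\<close>\<close>

definition xi :: "int \<Rightarrow> int \<Rightarrow> quat^2^2" where
  "xi k m = diag2 (Quat (\<i> * of_int k) 0) (Quat (\<i> * of_int m) 0)"

text \<open>\<open>frame x\<close> is some \<open>g \<in> Sp(2)\<close> with \<open>x = g[1,0,0,0]\<close>; the functions below do not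
  depend on which one.\<close>

definition frame :: "(complex^4) set \<Rightarrow> quat^2^2" where
  "frame x = (SOME g. g \<in> Sp2 \<and> cp_act g base_pt = x)"

definition conj_xi :: "quat^2^2 \<Rightarrow> (complex^4) set \<Rightarrow> quat^2^2" where
  "conj_xi \<xi> x = matrix_inv (frame x) ** \<xi> ** frame x"

definition q1 :: "quat^2^2 \<Rightarrow> (complex^4) set \<Rightarrow> quat" where
  "q1 \<xi> x = conj_xi \<xi> x $ 1 $ 1"

definition q2 :: "quat^2^2 \<Rightarrow> (complex^4) set \<Rightarrow> quat" where
  "q2 \<xi> x = conj_xi \<xi> x $ 2 $ 1"

definition q3 :: "quat^2^2 \<Rightarrow> (complex^4) set \<Rightarrow> quat" where
  "q3 \<xi> x = conj_xi \<xi> x $ 2 $ 2"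

definition Q3 :: "quat^2^2 \<Rightarrow> (complex^4) set \<Rightarrow> quat" where
  "Q3 \<xi> x = inverse (q2 \<xi> x) * q3 \<xi> x * q2 \<xi> x"

text \<open>In \<open>r_minus\<close> and \<open>r_plus\<close> the argument of \<open>Re\<close> is already real, because
  \<open>q1\<close> and \<open>Q3\<close> are imaginary quaternions.\<close>

definition v_minus :: "quat^2^2 \<Rightarrow> (complex^4) set \<Rightarrow> real" where
  "v_minus \<xi> x = (cmod (qJ (q1 \<xi> x)))\<^sup>2"

definition r_minus :: "quat^2^2 \<Rightarrow> (complex^4) set \<Rightarrow> real" where
  "r_minus \<xi> x = Re (2 * \<i> * qC (q1 \<xi> x))"

definition v_plus :: "quat^2^2 \<Rightarrow> (complex^4) set \<Rightarrow> real" where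
  "v_plus \<xi> x = (cmod (qJ (Q3 \<xi> x)))\<^sup>2"

definition r_plus :: "quat^2^2 \<Rightarrow> (complex^4) set \<Rightarrow> real" where
  "r_plus \<xi> x = Re (- 2 * \<i> * qC (Q3 \<xi> x))"

text \<open>The next two functions are evaluated on a representative, of an orbit and of a projective
  point respectively; the values are independent of it.\<close>

definition p_map :: "quat^2^2 \<Rightarrow> (complex^4) set set \<Rightarrow> real^4" where
  "p_map \<xi> X = (let x = SOME x. x \<in> X in
     vector [v_plus \<xi> x, v_minus \<xi> x, r_plus \<xi> x, r_minus \<xi> x])"

definition nu :: "(complex^4) set \<Rightarrow> real" where
  "nu x = (let Z = SOME Z. Z \<in> x in
     12 / norm Z ^ 4 * Im (Z $ 0 * Z $ 1 * cnj (Z $ 2) * cnj (Z $ 3)))"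

definition branch_set :: "(complex^4) set set set" where
  "branch_set = orb ` {x \<in> topspace CP3 - sing_lines. nu x = 0}"

section \<open>Branched double covers\<close>

text \<open>The analogue for abstract topologies of \<^const>\<open>covering_space\<close>, with exactly two sheets.\<close>

definition double_covering :: "'a topology \<Rightarrow> 'b topology \<Rightarrow> ('a \<Rightarrow> 'b) \<Rightarrow> bool" where
  "double_covering X Y p \<longleftrightarrow>
     continuous_map X Y p \<and> p ` topspace X = topspace Y \<and>
     (\<forall>y\<in>topspace Y. \<exists>V. y \<in> V \<and> openin Y V \<and>
        (\<exists>\<U>. card \<U> = 2 \<and> \<Union>\<U> = {x \<in> topspace X. p x \<in> V} \<and>
             (\<forall>U\<in>\<U>. openin X U) \<and> pairwise disjnt \<U> \<and>
             (\<forall>U\<in>\<U>. homeomorphic_map (subtopology X U) (subtopology Y V) p)))"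

text \<open>The branch locus \<open>L\<close> is a subset of the total space \<open>X\<close>.\<close>

definition branched_double_cover ::
  "'a topology \<Rightarrow> 'b topology \<Rightarrow> ('a \<Rightarrow> 'b) \<Rightarrow> 'a set \<Rightarrow> bool" where
  "branched_double_cover X Y p L \<longleftrightarrow>
     continuous_map X Y p \<and> p ` topspace X = topspace Y \<and> L \<subseteq> topspace X \<and>
     (\<forall>x\<in>topspace X. card {x' \<in> topspace X. p x' = p x} = (if x \<in> L then 1 else 2)) \<and>
     double_covering (subtopology X (topspace X - L))
       (subtopology Y (p ` (topspace X - L))) p"

end

theory Submission
  imports Defs
begin

text \<open>
  Write a unit representative as a pair \<open>(h\<^sub>1, h\<^sub>2)\<close> of quaternions, \<open>s = |h\<^sub>1|\<^sup>2\<close>, \<open>t = 1 - s\<close>, and let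
  \<open>a = h\<^sub>1\<inverse> i h\<^sub>1\<close> and \<open>b = h\<^sub>2\<inverse> i h\<^sub>2\<close> be the Hopf images, unit vectors in the space of imaginary
  quaternions. The torus orbit of the point is \<open>(a, b, s)\<close> up to rotations about the axis \<open>i\<close>, and
  \<open>\<delta>\<close> acts by a reflection in a plane containing that axis. One has \<open>q\<^sub>1 = ksa + mtb\<close>, and comparing
  the lower left entries of \<open>(g\<inverse> \<xi> g)\<^sup>2 = g\<inverse> \<xi>\<^sup>2 g\<close> gives
  \<open>Q\<^sub>3 = (k\<^sup>2 - m\<^sup>2)(ka - mb)/|ka - mb|\<^sup>2 - q\<^sub>1\<close>. Hence \<open>|q\<^sub>1|\<^sup>2 - |Q\<^sub>3|\<^sup>2 = (k\<^sup>2 - m\<^sup>2)(s - t)\<close> determines \<open>s\<close>,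
  then \<open>|q\<^sub>1|\<^sup>2\<close> determines \<open>a \<bullet> b\<close>, and the \<open>i\<close>-components of \<open>q\<^sub>1\<close> and \<open>Q\<^sub>3\<close> determine those of
  \<open>a\<close> and \<open>b\<close> linearly. These invariants fix \<open>(a, b)\<close> up to rotations and the reflection, that is,
  they fix the orbit up to \<open>\<delta>\<close>, and the two orbits agree exactly when \<open>a\<close>, \<open>b\<close> and \<open>i\<close> are coplanar,
  which is the condition \<open>\<nu> = 0\<close>. The inverse is explicit, so off the branch locus the two sheets
  \<open>\<nu> > 0\<close> and \<open>\<nu> < 0\<close> have continuous inverses over the whole base.
\<close>

section \<open>Coordinates indexed from 0 to 3\<close>

lemma UNIV_4_zero: "(UNIV :: 4 set) = {0, 1, 2, 3}"
proof -
  have "(4::4) = 0" by simp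
  show ?thesis unfolding UNIV_4 \<open>(4::4) = 0\<close> by blast
qed

lemma forall_4_zero: "(\<forall>i::4. P i) \<longleftrightarrow> P 0 \<and> P 1 \<and> P 2 \<and> P 3"
proof -
  have "(\<forall>i. P i) \<longleftrightarrow> (\<forall>i\<in>UNIV. P i)" by simp
  then show ?thesis unfolding UNIV_4_zero by simp
qed

lemma vec4_eq_iff: "(Z :: 'a^4) = W \<longleftrightarrow> Z $ 0 = W $ 0 \<and> Z $ 1 = W $ 1 \<and> Z $ 2 = W $ 2 \<and> Z $ 3 = W $ 3"
  by (simp add: vec_eq_iff forall_4_zero)

text \<open>The constructor \<open>vector\<close> starts at index 1, and \<open>4 = 0\<close> in
  this index type, so it puts the component of index 0 last. Here the order is that of the
  homogeneous coordinates.\<close>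

definition vec4 :: "'a \<Rightarrow> 'a \<Rightarrow> 'a \<Rightarrow> 'a \<Rightarrow> 'a^4" where
  "vec4 a b c d = (\<chi> i. if i = 0 then a else if i = 1 then b else if i = 2 then c else d)"

lemma vec4_nth [simp]:
  "vec4 a b c d $ 0 = a" "vec4 a b c d $ 1 = b" "vec4 a b c d $ 2 = c" "vec4 a b c d $ 3 = d"
  by (simp_all add: vec4_def)

lemma vector_4_nth:
  "(vector [a, b, c, d] :: 'a::zero^4) $ 1 = a" "(vector [a, b, c, d] :: 'a^4) $ 2 = b"
  "(vector [a, b, c, d] :: 'a^4) $ 3 = c" "(vector [a, b, c, d] :: 'a^4) $ 0 = d"
  by (simp_all add: vector_def)

section \<open>Orbit invariants\<close>

text \<open>The cone over the complement of the six lines: at most one coordinate vanishes, which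
  also excludes the zero vector.\<close>

definition regular_vecs :: "(complex^4) set" where
  "regular_vecs = {Z. \<forall>a b. a \<noteq> b \<longrightarrow> Z $ a \<noteq> 0 \<or> Z $ b \<noteq> 0}"

definition h1_norm2 :: "complex^4 \<Rightarrow> real" where "h1_norm2 Z = (cmod (Z$0))\<^sup>2 + (cmod (Z$1))\<^sup>2"
definition h2_norm2 :: "complex^4 \<Rightarrow> real" where "h2_norm2 Z = (cmod (Z$2))\<^sup>2 + (cmod (Z$3))\<^sup>2"

text \<open>\<open>alpha\<close> and \<open>beta\<close> are the \<open>i\<close>-components of the Hopf images \<open>a\<close> and \<open>b\<close>, while \<open>a_J\<close> and
  \<open>b_J\<close> are their \<open>j\<complex>\<close>-parts up to the common factor \<open>-i\<close>; \<open>cos_ab\<close> is the inner product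
  \<open>a \<bullet> b\<close> and \<open>diff_norm2 k m cos_ab\<close> is \<open>|ka - mb|\<^sup>2\<close>.\<close>

definition s_inv :: "complex^4 \<Rightarrow> real" where "s_inv Z = h1_norm2 Z / (h1_norm2 Z + h2_norm2 Z)"
definition alpha :: "complex^4 \<Rightarrow> real" where "alpha Z = ((cmod (Z$0))\<^sup>2 - (cmod (Z$1))\<^sup>2) / h1_norm2 Z"
definition beta :: "complex^4 \<Rightarrow> real" where "beta Z = ((cmod (Z$2))\<^sup>2 - (cmod (Z$3))\<^sup>2) / h2_norm2 Z"
definition a_J :: "complex^4 \<Rightarrow> complex" where "a_J Z = 2 * Z$0 * Z$1 / of_real (h1_norm2 Z)"
definition b_J :: "complex^4 \<Rightarrow> complex" where "b_J Z = 2 * Z$2 * Z$3 / of_real (h2_norm2 Z)"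
definition cos_ab :: "complex^4 \<Rightarrow> real" where "cos_ab Z = alpha Z * beta Z + Re (a_J Z * cnj (b_J Z))"

lemma regular_vecs_iff: "Z \<in> regular_vecs \<longleftrightarrow> (Z$0 \<noteq> 0 \<or> Z$1 \<noteq> 0) \<and> (Z$0 \<noteq> 0 \<or> Z$2 \<noteq> 0) \<and> (Z$0 \<noteq> 0 \<or> Z$3 \<noteq> 0)
   \<and> (Z$1 \<noteq> 0 \<or> Z$2 \<noteq> 0) \<and> (Z$1 \<noteq> 0 \<or> Z$3 \<noteq> 0) \<and> (Z$2 \<noteq> 0 \<or> Z$3 \<noteq> 0)"
  unfolding regular_vecs_def by (auto simp: forall_4_zero)

lemma h_norm2_pos: assumes "Z \<in> regular_vecs" shows "h1_norm2 Z > 0" "h2_norm2 Z > 0"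
  using assms unfolding regular_vecs_iff h1_norm2_def h2_norm2_def
  by (auto simp: sum_power2_gt_zero_iff)

text \<open>The Hopf image is a unit vector, by \<open>(x - y)^2 + 4xy = (x + y)^2\<close> for the
  squared moduli x, y of the two coordinates.\<close>

lemma sphere_a: assumes "h1_norm2 Z > 0" shows "(cmod (a_J Z))\<^sup>2 = 1 - (alpha Z)\<^sup>2"
proof -
  have "(cmod (a_J Z))\<^sup>2 * (h1_norm2 Z)\<^sup>2 = 4 * (cmod (Z$0))\<^sup>2 * (cmod (Z$1))\<^sup>2"
    using assms by (simp add: a_J_def norm_mult norm_divide power_mult_distrib power_divide)
  moreover have "(alpha Z)\<^sup>2 * (h1_norm2 Z)\<^sup>2 = ((cmod (Z$0))\<^sup>2 - (cmod (Z$1))\<^sup>2)\<^sup>2"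
    using assms by (simp add: alpha_def power_divide)
  ultimately have "((cmod (a_J Z))\<^sup>2 + (alpha Z)\<^sup>2) * (h1_norm2 Z)\<^sup>2 = 1 * (h1_norm2 Z)\<^sup>2"
    by (simp add: distrib_right h1_norm2_def) (simp add: power2_eq_square algebra_simps)
  then show ?thesis using assms by (simp del: mult_1)
qed

lemma sphere_b: assumes "h2_norm2 Z > 0" shows "(cmod (b_J Z))\<^sup>2 = 1 - (beta Z)\<^sup>2"
  using sphere_a[of "vec4 (Z$2) (Z$3) 0 0"] assms
  by (simp add: h1_norm2_def h2_norm2_def a_J_def b_J_def alpha_def beta_def)

lemma s_bounds: assumes "Z \<in> regular_vecs" shows "0 < s_inv Z" "s_inv Z < 1"
  using h_norm2_pos[OF assms] by (simp_all add: s_inv_def field_simps)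

definition diff_norm2 :: "real \<Rightarrow> real \<Rightarrow> real \<Rightarrow> real" where "diff_norm2 k m c = k\<^sup>2 + m\<^sup>2 - 2 * k * m * c"

lemma cmod_lincomb_sq:
  "(cmod (of_real x * a + of_real y * b))\<^sup>2 =
     x\<^sup>2 * (cmod a)\<^sup>2 + y\<^sup>2 * (cmod b)\<^sup>2 + 2 * x * y * Re (a * cnj b)"
  unfolding cmod_power2 by (simp add: power2_eq_square algebra_simps)

lemma diff_norm2_eq: assumes "h1_norm2 Z > 0" "h2_norm2 Z > 0"
  shows "diff_norm2 k m (cos_ab Z) = (k * alpha Z - m * beta Z)\<^sup>2 + (cmod (of_real k * a_J Z - of_real m * b_J Z))\<^sup>2"
proof -
  have "(cmod (of_real k * a_J Z - of_real m * b_J Z))\<^sup>2 =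
      k\<^sup>2 * (1 - (alpha Z)\<^sup>2) + m\<^sup>2 * (1 - (beta Z)\<^sup>2) - 2 * k * m * Re (a_J Z * cnj (b_J Z))"
    using cmod_lincomb_sq[of k "a_J Z" "-m" "b_J Z"] sphere_a[of Z] sphere_b[of Z] assms
    by simp
  then show ?thesis unfolding diff_norm2_def cos_ab_def power2_eq_square by (simp add: algebra_simps)
qed

text \<open>The squared lengths of a - b and a + b are 2 - 2c and 2 + 2c with c =
  \<open>cos_ab Z\<close>, and both are nonnegative.\<close>

lemma cos_ab_abs_le_1: assumes "h1_norm2 Z > 0" "h2_norm2 Z > 0" shows "\<bar>cos_ab Z\<bar> \<le> 1"
proof -
  have "0 \<le> diff_norm2 1 1 (cos_ab Z)" "0 \<le> diff_norm2 1 (-1) (cos_ab Z)" using diff_norm2_eq[OF assms] by simp_all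
  then show ?thesis by (simp add: diff_norm2_def)
qed

text \<open>Vanishing would mean ka = mb, and comparing the lengths of these multiples of unit
  vectors would give \<open>k^2 = m^2\<close>.\<close>

lemma diff_norm2_pos: assumes "h1_norm2 Z > 0" "h2_norm2 Z > 0" "k\<^sup>2 \<noteq> m\<^sup>2" shows "diff_norm2 k m (cos_ab Z) > 0"
proof (rule ccontr)
  assume "\<not> ?thesis"
  then have 0: "k * alpha Z = m * beta Z" "of_real k * a_J Z = of_real m * b_J Z"
    unfolding diff_norm2_eq[OF assms(1,2)] by (auto simp: not_less sum_power2_le_zero_iff)
  have "k\<^sup>2 * (alpha Z)\<^sup>2 + k\<^sup>2 * (cmod (a_J Z))\<^sup>2 = (k * alpha Z)\<^sup>2 + (cmod (of_real k * a_J Z))\<^sup>2"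
    by (simp add: power_mult_distrib norm_mult)
  also have "\<dots> = m\<^sup>2 * (beta Z)\<^sup>2 + m\<^sup>2 * (cmod (b_J Z))\<^sup>2"
    unfolding 0 by (simp add: power_mult_distrib norm_mult)
  finally show False
    using sphere_a[of Z] sphere_b[of Z] assms(1,2) assms(3) by (simp add: algebra_simps)
qed

section \<open>The functions in terms of a representative\<close>

lemma quat_eq_iff: "p = q \<longleftrightarrow> qC p = qC q \<and> qJ p = qJ q" by (cases p; cases q) simp

lemmas quat_defs = quat_eq_iff zero_quat_def one_quat_def plus_quat_def minus_quat_def
  uminus_quat_def times_quat_def qcnj_def

lemma matrix_matrix_mult_2: "(A ** B) $ i $ j = A$i$1 * B$1$j + A$i$2 * (B$2$j)"
  for A B :: "'a::semiring_1^2^2"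
  by (simp add: matrix_matrix_mult_def sum_2)

lemma matrix_inv_Sp2: assumes "g \<in> Sp2" shows "matrix_inv g = adjoint_mat g"
proof -
  have "g ** matrix_inv g = mat 1 \<and> matrix_inv g ** g = mat 1"
    unfolding matrix_inv_def by (rule someI_ex) (use assms in \<open>auto simp: Sp2_def\<close>)
  then have "matrix_inv g = adjoint_mat g ** g ** matrix_inv g"
    using assms by (simp add: Sp2_def)
  also have "\<dots> = adjoint_mat g"
    using \<open>_ \<and> _\<close> by (simp flip: matrix_mul_assoc)
  finally show ?thesis .
qed

lemma diag2_nth [simp]: "diag2 a b $ 1 $ 1 = a" "diag2 a b $ 1 $ 2 = 0"
   "diag2 a b $ 2 $ 1 = 0" "diag2 a b $ 2 $ 2 = b"
  by (simp_all add: diag2_def)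

lemma adjoint_nth [simp]: "adjoint_mat g $ i $ j = qcnj (g $ j $ i)"
  by (simp add: adjoint_mat_def)

lemma hvec_nth [simp]: "hvec Z $ 1 = Quat (Z$0) (Z$1)" "hvec Z $ 2 = Quat (Z$2) (Z$3)"
  by (simp_all add: hvec_def)

text \<open>The second column is (h1 r, -h2 / r) with real r > 0 and r^2 = |h2|^2 / |h1|^2. Real
  scalars are central, so the pairing of the two columns is |h1|^2 r - |h2|^2 / r = 0, and the
  second one has squared norm |h2|^2 + |h1|^2 = 1.\<close>

lemma Sp2_exists_column:
  assumes "h1_norm2 V > 0" "h2_norm2 V > 0" "h1_norm2 V + h2_norm2 V = 1"
  shows "\<exists>g\<in>Sp2. g$1$1 = Quat (V$0) (V$1) \<and> g$2$1 = Quat (V$2) (V$3)"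
proof -
  define r where "r = complex_of_real (sqrt (h2_norm2 V / h1_norm2 V))"
  define i where "i = inverse r"
  have "(sqrt (h2_norm2 V / h1_norm2 V))\<^sup>2 * h1_norm2 V = h2_norm2 V" "sqrt (h2_norm2 V / h1_norm2 V) \<noteq> 0"
    using assms by simp_all
  then have r: "r * r * of_real (h1_norm2 V) = of_real (h2_norm2 V)" "r * i = 1" "cnj r = r" "cnj i = i"
    unfolding r_def i_def by (simp_all flip: power2_eq_square of_real_power of_real_mult)
  have N: "complex_of_real (h1_norm2 V) + of_real (h2_norm2 V) = 1"
    using assms(3) by (simp flip: of_real_add)
  define g :: "quat^2^2" where "g = vector [vector [Quat (V$0) (V$1), Quat (V$0 * r) (V$1 * r)],
     vector [Quat (V$2) (V$3), Quat (- (V$2 * i)) (- (V$3 * i))]]"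
  have g: "g$1$1 = Quat (V$0) (V$1)" "g$1$2 = Quat (V$0 * r) (V$1 * r)"
    "g$2$1 = Quat (V$2) (V$3)" "g$2$2 = Quat (- (V$2 * i)) (- (V$3 * i))" by (simp_all add: g_def)
  have c: "of_real (h1_norm2 V) = V$0 * cnj (V$0) + V$1 * cnj (V$1)"
    "of_real (h2_norm2 V) = V$2 * cnj (V$2) + V$3 * cnj (V$3)"
    unfolding h1_norm2_def h2_norm2_def of_real_add complex_norm_square by simp_all
  have e1: "of_real (h1_norm2 V) * r = of_real (h2_norm2 V) * i"
    unfolding r(1)[symmetric] using r(2) by algebra
  then have e2: "of_real (h2_norm2 V) * (i * i) = of_real (h1_norm2 V)"
    using r(2) by algebra
  note r = r[unfolded c] and N = N[unfolded c] and e = e1[unfolded c] e2[unfolded c]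
  have "(g ** adjoint_mat g) $ 1 $ 1 = 1 \<and>
      (g ** adjoint_mat g) $ 1 $ 2 = 0 \<and>
      (g ** adjoint_mat g) $ 2 $ 1 = 0 \<and>
      (g ** adjoint_mat g) $ 2 $ 2 = 1 \<and>
      (adjoint_mat g ** g) $ 1 $ 1 = 1 \<and>
      (adjoint_mat g ** g) $ 1 $ 2 = 0 \<and>
      (adjoint_mat g ** g) $ 2 $ 1 = 0 \<and>
      (adjoint_mat g ** g) $ 2 $ 2 = 1"
    unfolding matrix_matrix_mult_2 adjoint_nth g quat_defs quat.sel complex_cnj_mult complex_cnj_minus complex_cnj_cnj r(3,4)
    by (intro conjI; ((simp; fail) | (use r(1,2) N e in algebra)))
  then have "g ** adjoint_mat g = mat 1" "adjoint_mat g ** g = mat 1"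
    by (simp_all add: vec_eq_iff forall_2 mat_def)
  then show ?thesis using g by (auto simp: Sp2_def)
qed


section \<open>Hopf images and the entries of the conjugated matrix\<close>

lemma cmod_sq_of_real: "complex_of_real ((cmod z)\<^sup>2) = z * cnj z"
  using complex_norm_square by simp

text \<open>For x = 1 this is the Hopf map scaled by |h|^2, where h = z + jw. The j-part carries the
  factor -i that \<open>a_J\<close> and \<open>b_J\<close> leave out.\<close>

lemma qcnj_conj_i:
  "qcnj (Quat z w) * Quat (\<i> * of_real x) 0 * Quat z w =
     Quat (\<i> * of_real (x * ((cmod z)\<^sup>2 - (cmod w)\<^sup>2))) (- \<i> * of_real x * (2 * z * w))"
  unfolding of_real_mult of_real_diff cmod_sq_of_real by (simp add: quat_defs algebra_simps)

lemma inverse_conj_i: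
  "inverse (Quat z w) * Quat (\<i> * of_real x) 0 * Quat z w =
     Quat (\<i> * of_real (x * (((cmod z)\<^sup>2 - (cmod w)\<^sup>2) / ((cmod z)\<^sup>2 + (cmod w)\<^sup>2))))
       (- \<i> * of_real x * (2 * z * w / of_real ((cmod z)\<^sup>2 + (cmod w)\<^sup>2)))"
proof -
  define N where "N = inverse (complex_of_real ((cmod z)\<^sup>2 + (cmod w)\<^sup>2))"
  have [simp]: "cnj N = N" by (simp add: N_def)
  have "inverse (Quat z w) = Quat N 0 * qcnj (Quat z w)"
    by (simp add: inverse_quat_def qnorm2_def N_def divide_inverse quat_defs)
  then have "inverse (Quat z w) * Quat (\<i> * of_real x) 0 * Quat z w =
      Quat N 0 * Quat (\<i> * of_real (x * ((cmod z)\<^sup>2 - (cmod w)\<^sup>2))) (- \<i> * of_real x * (2 * z * w))"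
    unfolding qcnj_conj_i[symmetric] by (simp only: mult.assoc)
  then show ?thesis by (simp add: N_def divide_inverse quat_defs)
qed

lemma real_quat_commute: "Quat (of_real r) 0 * q = q * Quat (of_real r) 0"
  by (simp add: quat_defs)

lemma imaginary_quat_square: "Quat (\<i> * of_real x) 0 * Quat (\<i> * of_real x) 0 = Quat (of_real (- x\<^sup>2)) 0"
  by (simp add: quat_defs complex_eq_iff power2_eq_square)

definition xi_real :: "real \<Rightarrow> real \<Rightarrow> quat^2^2" where
  "xi_real k m = diag2 (Quat (\<i> * of_real k) 0) (Quat (\<i> * of_real m) 0)"

text \<open>On \<open>Sp2\<close> the adjoint is the inverse, so for such g this is the conjugate of
  \<open>xi_real k m\<close> by the inverse of g.\<close>

definition conj_real :: "quat^2^2 \<Rightarrow> real \<Rightarrow> real \<Rightarrow> quat^2^2" where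
  "conj_real g k m = adjoint_mat g ** xi_real k m ** g"

context
  fixes g :: "quat^2^2" and V :: "complex^4" and k m :: real
  assumes g: "g \<in> Sp2" and col: "g$1$1 = Quat (V$0) (V$1)" "g$2$1 = Quat (V$2) (V$3)"
    and pos: "h1_norm2 V > 0" "h2_norm2 V > 0" and km: "k\<^sup>2 \<noteq> m\<^sup>2"
begin

private abbreviation "X \<equiv> xi_real k m"
private abbreviation "A \<equiv> conj_real g k m"

lemma column_norm: "h1_norm2 V + h2_norm2 V = 1"
proof -
  have "(adjoint_mat g ** g) $ 1 $ 1 = (mat 1 :: quat^2^2) $ 1 $ 1" using g by (simp add: Sp2_def)
  then have "cnj (V$0) * V$0 + cnj (V$1) * V$1 + (cnj (V$2) * V$2 + cnj (V$3) * V$3) = 1"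
    by (simp add: matrix_matrix_mult_2 col mat_def quat_defs)
  then have "complex_of_real (h1_norm2 V + h2_norm2 V) = 1"
    unfolding h1_norm2_def h2_norm2_def of_real_add cmod_sq_of_real by (simp add: mult.commute)
  then show ?thesis by (simp only: of_real_eq_1_iff)
qed

text \<open>The entry is the sum of the conjugates of ik by h1 and of im by h2, scaled by |h1|^2 and
  |h2|^2. These are s and 1 - s because the first column of g has norm 1.\<close>

lemma conj_real_11: "A $ 1 $ 1 = Quat (\<i> * of_real (k * s_inv V * alpha V + m * (1 - s_inv V) * beta V))
    (- \<i> * (of_real (k * s_inv V) * a_J V + of_real (m * (1 - s_inv V)) * b_J V))"
proof -
  have "A $ 1 $ 1 = qcnj (g$1$1) * Quat (\<i> * of_real k) 0 * g$1$1 + qcnj (g$2$1) * Quat (\<i> * of_real m) 0 * g$2$1"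
    by (simp add: conj_real_def xi_real_def matrix_matrix_mult_2)
  moreover have "s_inv V = h1_norm2 V" "1 - s_inv V = h2_norm2 V"
    using column_norm by (simp_all add: s_inv_def)
  ultimately show ?thesis
    unfolding col qcnj_conj_i
    using pos by (simp add: alpha_def beta_def a_J_def b_J_def) (simp add: quat_defs algebra_simps)
qed

text \<open>The second column of g enters \<open>A$2$1\<close> and the lower left entry of
  \<open>A ** A\<close> only through one left factor \<open>e\<close>. Dividing by
  \<open>A$2$1\<close> on the left cancels it, so Q3 depends on the first column alone.\<close>

lemma conj_real_Q3: "inverse (A$2$1) * A$2$2 * A$2$1 =
    Quat (\<i> * of_real ((k\<^sup>2 - m\<^sup>2) / diff_norm2 k m (cos_ab V) * (k * alpha V - m * beta V)))
      (- \<i> * of_real ((k\<^sup>2 - m\<^sup>2) / diff_norm2 k m (cos_ab V)) * (of_real k * a_J V - of_real m * b_J V)) - A$1$1"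
proof -
  let ?h1 = "g$1$1" and ?h2 = "g$2$1"
  define e where "e = qcnj (g$1$2) * ?h1"
  have h: "?h1 \<noteq> 0" "?h2 \<noteq> 0"
    using pos by (auto simp: col zero_quat_def h1_norm2_def h2_norm2_def)
  \<comment> \<open>The two columns of g are orthogonal.\<close>
  have "(adjoint_mat g ** g) $ 2 $ 1 = (mat 1 :: quat^2^2) $ 2 $ 1" using g by (simp add: Sp2_def)
  then have e2: "qcnj (g$2$2) * ?h2 = - e"
    by (simp add: matrix_matrix_mult_2 mat_def e_def eq_neg_iff_add_eq_0 add.commute)
  \<comment> \<open>Otherwise both entries of the second column would vanish, since h1 and h2 are
    invertible, against its norm being 1.\<close>
  have e0: "e \<noteq> 0"
  proof
    assume "e = 0"
    then have "qcnj (g$1$2) = 0" "qcnj (g$2$2) = 0" using h e2 by (auto simp: e_def)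
    then have "(adjoint_mat g ** g) $ 2 $ 2 = 0" by (simp add: matrix_matrix_mult_2)
    then show False using g by (simp add: Sp2_def mat_def)
  qed
  \<comment> \<open>These are the Hopf images already multiplied by k and m.\<close>
  define a where "a = inverse ?h1 * Quat (\<i> * of_real k) 0 * ?h1"
  define b where "b = inverse ?h2 * Quat (\<i> * of_real m) 0 * ?h2"
  have "A$2$1 = qcnj (g$1$2) * Quat (\<i> * of_real k) 0 * ?h1 + qcnj (g$2$2) * Quat (\<i> * of_real m) 0 * ?h2"
    by (simp add: conj_real_def xi_real_def matrix_matrix_mult_2)
  also have "\<dots> = e * a + (qcnj (g$2$2) * ?h2) * b"
    using h by (simp add: e_def a_def b_def mult.assoc) (simp flip: mult.assoc)
  finally have A21: "A$2$1 = e * (a - b)" by (simp add: e2 algebra_simps)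
  have ab: "a - b = Quat (\<i> * of_real (k * alpha V - m * beta V)) (- \<i> * (of_real k * a_J V - of_real m * b_J V))"
    unfolding a_def b_def col inverse_conj_i
    by (simp add: alpha_def beta_def a_J_def b_J_def h1_norm2_def h2_norm2_def quat_defs algebra_simps)
  \<comment> \<open>The square of \<open>X\<close> is diagonal with entries -k^2 and -m^2, which are
    real and hence central.\<close>
  have "A ** A = adjoint_mat g ** X ** (g ** adjoint_mat g) ** X ** g"
    by (simp add: conj_real_def matrix_mul_assoc)
  also have "\<dots> = adjoint_mat g ** (X ** X) ** g"
    using g by (simp add: Sp2_def matrix_mul_assoc)
  finally have "(A ** A) $ 2 $ 1 = (adjoint_mat g ** (X ** X) ** g) $ 2 $ 1" by simp
  then have "A$2$1 * A$1$1 + A$2$2 * A$2$1 =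
     qcnj (g$1$2) * (Quat (of_real (- k\<^sup>2)) 0) * ?h1 + qcnj (g$2$2) * (Quat (of_real (- m\<^sup>2)) 0) * ?h2"
    by (simp add: matrix_matrix_mult_2 xi_real_def imaginary_quat_square)
  also have "\<dots> = Quat (of_real (- k\<^sup>2)) 0 * e + Quat (of_real (- m\<^sup>2)) 0 * (qcnj (g$2$2) * ?h2)"
    unfolding real_quat_commute[of _ "qcnj _", symmetric] by (simp only: e_def mult.assoc)
  also have "\<dots> = e * Quat (of_real (m\<^sup>2 - k\<^sup>2)) 0"
    unfolding e2 real_quat_commute by (simp add: quat_defs algebra_simps)
  finally have "A$2$2 * A$2$1 = e * Quat (of_real (m\<^sup>2 - k\<^sup>2)) 0 - A$2$1 * A$1$1"
    by (simp add: algebra_simps)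
  moreover have q: "qnorm2 (a - b) = diff_norm2 k m (cos_ab V)"
    unfolding diff_norm2_eq[OF pos] ab qnorm2_def quat.sel norm_mult norm_minus_cancel norm_of_real by simp
  moreover have d0: "diff_norm2 k m (cos_ab V) > 0" using diff_norm2_pos[OF pos km] .
  moreover have ab0: "a - b \<noteq> 0" using q d0 by (auto simp: qnorm2_def zero_quat_def)
  then have "A$2$1 \<noteq> 0" using e0 A21 by simp
  ultimately have "inverse (A$2$1) * (A$2$2 * A$2$1) = inverse (A$2$1) * (e * Quat (of_real (m\<^sup>2 - k\<^sup>2)) 0) - A$1$1"
    by (simp only: right_diff_distrib) (simp flip: mult.assoc)
  then have "inverse (A$2$1) * A$2$2 * A$2$1 = inverse (e * (a - b)) * (e * Quat (of_real (m\<^sup>2 - k\<^sup>2)) 0) - A$1$1"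
    by (simp only: mult.assoc A21)
  also have "inverse (e * (a - b)) * (e * Quat (of_real (m\<^sup>2 - k\<^sup>2)) 0) = inverse (a - b) * Quat (of_real (m\<^sup>2 - k\<^sup>2)) 0"
    using e0 ab0 by (simp add: nonzero_inverse_mult_distrib mult.assoc) (simp flip: mult.assoc)
  \<comment> \<open>The quaternion \<open>a - b\<close> is imaginary, so its inverse is -(a - b) /
    |a - b|^2. This turns m^2 - k^2 into k^2 - m^2.\<close>
  also have "\<dots> = Quat (\<i> * of_real ((k\<^sup>2 - m\<^sup>2) / diff_norm2 k m (cos_ab V) * (k * alpha V - m * beta V)))
      (- \<i> * of_real ((k\<^sup>2 - m\<^sup>2) / diff_norm2 k m (cos_ab V)) * (of_real k * a_J V - of_real m * b_J V))"
    unfolding inverse_quat_def q unfolding ab using d0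
    by (simp add: quat_defs field_simps)
  finally show ?thesis .
qed

end

section \<open>Frames and homogeneous coordinates\<close>

lemma hvec_eq_iff: "hvec Z = hvec W \<longleftrightarrow> Z = W"
  by (simp add: vec_eq_iff[of "hvec Z"] forall_2 vec4_eq_iff)

lemma matrix_vector_mult_2: "((A :: 'a::semiring_1^2^2) *v v) $ i = A$i$1 * v$1 + A$i$2 * v$2"
  by (simp add: matrix_vector_mult_def sum_2)

lemma cls_smult: "c \<noteq> 0 \<Longrightarrow> cls (c *s Z) = cls Z"
proof -
  assume c: "c \<noteq> 0"
  have "\<exists>e. W = e *s (c *s Z) \<and> e \<noteq> 0" if "W = d *s Z" "d \<noteq> 0" for W d
    using that c by (intro exI[of _ "d / c"]) (simp add: vector_smult_assoc)
  then show ?thesis unfolding cls_def using c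
    by (auto simp: vector_smult_assoc)
qed

lemma cls_refl: "Z \<in> cls Z"
  unfolding cls_def by (auto intro!: exI[of _ 1])

lemma column_in_class:
  assumes "cp_act g base_pt = x"
  shows "\<exists>V\<in>x. g$1$1 = Quat (V$0) (V$1) \<and> g$2$1 = Quat (V$2) (V$3)"
proof
  let ?V = "vec4 (qC (g$1$1)) (qJ (g$1$1)) (qC (g$2$1)) (qJ (g$2$1))"
  have "hvec ?V = g *v hvec (axis 0 1)"
    by (simp add: vec_eq_iff forall_2 matrix_vector_mult_2 axis_def quat_defs)
  then show "?V \<in> x"
    using cls_refl unfolding assms[symmetric] cp_act_def base_pt_def by blast
qed simp

text \<open>Complex scalars act on \<open>hvec\<close> by right multiplication and so commute with
  g; the whole class of the base vector goes to the class of the first column.\<close>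

lemma cp_act_base:
  assumes "g$1$1 = Quat (V$0) (V$1)" "g$2$1 = Quat (V$2) (V$3)"
  shows "cp_act g base_pt = cls V"
proof -
  have "g *v hvec (c *s axis 0 1) = hvec (c *s V)" for c
    by (simp add: vec_eq_iff forall_2 matrix_vector_mult_2 axis_def assms) (simp add: quat_defs)
  then have "hvec W = g *v hvec (c *s axis 0 1) \<longleftrightarrow> W = c *s V" for W c
    by (simp add: hvec_eq_iff)
  then show ?thesis unfolding cp_act_def base_pt_def cls_def by auto
qed

lemma cmod_smult: "cmod ((c *s Z) $ i) = cmod c * cmod (Z $ i)"
  by (simp add: norm_mult)

lemma h_norm2_smult: "h1_norm2 (c *s Z) = (cmod c)\<^sup>2 * h1_norm2 Z" "h2_norm2 (c *s Z) = (cmod c)\<^sup>2 * h2_norm2 Z"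
  unfolding h1_norm2_def h2_norm2_def cmod_smult power_mult_distrib by (simp_all add: algebra_simps)

text \<open>As \<open>frame\<close> is a choice, only existence is at stake: the representative is
  scaled to norm 1 and completed to a matrix.\<close>

lemma frame_works:
  assumes "h1_norm2 Z > 0" "h2_norm2 Z > 0"
  shows "frame (cls Z) \<in> Sp2 \<and> cp_act (frame (cls Z)) base_pt = cls Z"
  unfolding frame_def
proof (rule someI_ex)
  define r where "r = 1 / sqrt (h1_norm2 Z + h2_norm2 Z)"
  let ?V = "complex_of_real r *s Z"
  have r: "r > 0" "r\<^sup>2 * (h1_norm2 Z + h2_norm2 Z) = 1" using assms by (simp_all add: r_def power_divide)
  have "h1_norm2 ?V > 0" "h2_norm2 ?V > 0" "h1_norm2 ?V + h2_norm2 ?V = 1"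
    using assms r by (simp_all add: h_norm2_smult algebra_simps)
  from Sp2_exists_column[OF this] obtain g where g: "g \<in> Sp2"
    "g$1$1 = Quat (?V$0) (?V$1)" "g$2$1 = Quat (?V$2) (?V$3)" by blast
  moreover have "cls ?V = cls Z" by (rule cls_smult) (use r in simp)
  ultimately show "\<exists>g. g \<in> Sp2 \<and> cp_act g base_pt = cls Z"
    using cp_act_base[OF g(2,3)] by auto
qed

lemma invariants_smult:
  assumes "c \<noteq> 0"
  shows "s_inv (c *s Z) = s_inv Z" "alpha (c *s Z) = alpha Z" "beta (c *s Z) = beta Z" "cos_ab (c *s Z) = cos_ab Z"
proof -
  show s: "s_inv (c *s Z) = s_inv Z" and alpha: "alpha (c *s Z) = alpha Z" and beta: "beta (c *s Z) = beta Z"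
    unfolding s_inv_def alpha_def beta_def h_norm2_smult cmod_smult power_mult_distrib
      right_diff_distrib[symmetric] distrib_left[symmetric]
    using assms by simp_all
  \<comment> \<open>Both \<open>a_J\<close> and \<open>b_J\<close> are multiplied by this phase,
    which cancels when one is multiplied by the conjugate of the other.\<close>
  define u where "u = c * c / of_real ((cmod c)\<^sup>2)"
  have "cmod u = 1"
    using assms by (simp add: u_def norm_divide norm_mult power2_eq_square)
  then have "u * cnj u = 1" by (simp flip: complex_norm_square)
  moreover have "a_J (c *s Z) = u * a_J Z" "b_J (c *s Z) = u * b_J Z"
    by (simp_all add: a_J_def b_J_def h_norm2_smult u_def)
  ultimately have "a_J (c *s Z) * cnj (b_J (c *s Z)) = a_J Z * cnj (b_J Z)"
    by (simp add: mult_ac)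
  then show "cos_ab (c *s Z) = cos_ab Z" by (simp add: cos_ab_def alpha beta)
qed

text \<open>Here \<open>\<rho>\<close> and \<open>\<sigma>\<close> are the \<open>i\<close>-components of \<open>q\<^sub>1\<close> and \<open>Q\<^sub>3\<close>; the first two entries have the
  form \<open>|Q\<^sub>3|\<^sup>2 - \<sigma>\<^sup>2\<close> and \<open>|q\<^sub>1|\<^sup>2 - \<rho>\<^sup>2\<close>.\<close>

definition p_formula :: "real \<Rightarrow> real \<Rightarrow> real \<Rightarrow> real \<Rightarrow> real \<Rightarrow> real \<Rightarrow> real^4" where
  "p_formula k m s a b c =
    (let \<rho> = k * s * a + m * (1 - s) * b; l = (k\<^sup>2 - m\<^sup>2) / diff_norm2 k m c; n = 2 * k * m * s * (1 - s) * c;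
         \<sigma> = l * (k * a - m * b) - \<rho>
     in vector [k\<^sup>2 * (1 - s)\<^sup>2 + m\<^sup>2 * s\<^sup>2 + n - \<sigma>\<^sup>2, k\<^sup>2 * s\<^sup>2 + m\<^sup>2 * (1 - s)\<^sup>2 + n - \<rho>\<^sup>2, 2 * \<sigma>, - 2 * \<rho>])"

text \<open>The left side is |Q3|^2 for Q3 = (lk - ks)a - (lm + m(1 - s))b with unit vectors a, b of
  inner product c. The right side is |q1|^2 with s and 1 - s interchanged.\<close>

lemma Q_norm_identity:
  fixes k m s l c :: real
  assumes "l * diff_norm2 k m c = k\<^sup>2 - m\<^sup>2"
  shows "(l * k - k * s)\<^sup>2 + (l * m + m * (1 - s))\<^sup>2 - 2 * (l * k - k * s) * (l * m + m * (1 - s)) * c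
       = k\<^sup>2 * (1 - s)\<^sup>2 + m\<^sup>2 * s\<^sup>2 + 2 * k * m * s * (1 - s) * c"
  using assms unfolding diff_norm2_def power2_eq_square by algebra

text \<open>The first column V of the chosen frame is some multiple of Z. The four values depend on
  V only through \<open>s_inv\<close>, \<open>alpha\<close>, \<open>beta\<close> and
  \<open>cos_ab\<close>, which do not see the factor.\<close>

lemma functions_eq:
  fixes k m :: int
  assumes "h1_norm2 Z > 0" "h2_norm2 Z > 0" and km: "(real_of_int k)\<^sup>2 \<noteq> (real_of_int m)\<^sup>2"
  shows "vector [v_plus (xi k m) (cls Z), v_minus (xi k m) (cls Z), r_plus (xi k m) (cls Z), r_minus (xi k m) (cls Z)]
    = p_formula k m (s_inv Z) (alpha Z) (beta Z) (cos_ab Z)"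
proof -
  let ?g = "frame (cls Z)"
  have g: "?g \<in> Sp2" "cp_act ?g base_pt = cls Z" using frame_works[OF assms(1,2)] by auto
  from column_in_class[OF g(2)] obtain V where V: "V \<in> cls Z"
    and col: "?g$1$1 = Quat (V$0) (V$1)" "?g$2$1 = Quat (V$2) (V$3)" by blast
  from V obtain c where c: "c \<noteq> 0" "V = c *s Z" by (auto simp: cls_def)
  have pos: "h1_norm2 V > 0" "h2_norm2 V > 0" using assms c by (simp_all add: h_norm2_smult)
  have A: "conj_xi (xi k m) (cls Z) = conj_real ?g k m"
    by (simp add: conj_xi_def conj_real_def xi_def xi_real_def matrix_inv_Sp2[OF g(1)])
  note q = conj_real_11[OF g(1) col pos km] conj_real_Q3[OF g(1) col pos km]
  define s where "s = s_inv V"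
  define l where "l = (real_of_int k^2 - real_of_int m^2) / diff_norm2 k m (cos_ab V)"
  define \<rho> where "\<rho> = k * s * alpha V + m * (1 - s) * beta V"
  have q1: "q1 (xi k m) (cls Z) = Quat (\<i> * of_real \<rho>)
      (- \<i> * (of_real (k * s) * a_J V + of_real (m * (1 - s)) * b_J V))"
    unfolding q1_def A q(1) \<rho>_def s_def ..
  have Q: "Q3 (xi k m) (cls Z) = Quat (\<i> * of_real (l * (k * alpha V - m * beta V) - \<rho>))
     (- \<i> * (of_real (l * k - k * s) * a_J V + of_real (- (l * m + m * (1 - s))) * b_J V))"
    unfolding Q3_def q2_def q3_def A q(2) q1[unfolded q1_def A] l_def[symmetric]
    by (simp add: quat_defs algebra_simps)
  have sph: "(cmod (a_J V))\<^sup>2 = 1 - (alpha V)\<^sup>2" "(cmod (b_J V))\<^sup>2 = 1 - (beta V)\<^sup>2"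
    "Re (a_J V * cnj (b_J V)) = cos_ab V - alpha V * beta V"
    using sphere_a[OF pos(1)] sphere_b[OF pos(2)] by (simp_all add: cos_ab_def)
  have "l * diff_norm2 k m (cos_ab V) = k^2 - m^2" using diff_norm2_pos[OF pos km] by (simp add: l_def)
  note Qn = Q_norm_identity[OF this[unfolded of_int_power of_int_diff], of s]
  have "v_minus (xi k m) (cls Z) = k\<^sup>2 * s\<^sup>2 + m\<^sup>2 * (1 - s)\<^sup>2 + 2 * k * m * s * (1 - s) * cos_ab V - \<rho>\<^sup>2"
    unfolding v_minus_def q1 quat.sel norm_mult norm_minus_cancel norm_ii mult_1 cmod_lincomb_sq sph \<rho>_def
    by (simp add: power2_eq_square algebra_simps)
  moreover have "v_plus (xi k m) (cls Z) = k\<^sup>2 * (1 - s)\<^sup>2 + m\<^sup>2 * s\<^sup>2 + 2 * k * m * s * (1 - s) * cos_ab V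
      - (l * (k * alpha V - m * beta V) - \<rho>)\<^sup>2"
    unfolding v_plus_def Q quat.sel norm_mult norm_minus_cancel norm_ii mult_1 cmod_lincomb_sq sph \<rho>_def
    using Qn by (simp add: power2_eq_square algebra_simps)
  moreover have "r_minus (xi k m) (cls Z) = - 2 * \<rho>"
    unfolding r_minus_def q1 by simp
  moreover have "r_plus (xi k m) (cls Z) = 2 * (l * (k * alpha V - m * beta V) - \<rho>)"
    unfolding r_plus_def Q by simp
  ultimately show ?thesis
    unfolding p_formula_def Let_def invariants_smult[OF c(1), of Z, folded c(2), symmetric]
    by (simp add: l_def \<rho>_def s_def)
qed

section \<open>Inverting the map\<close>

text \<open>The fourth component of a vector in \<open>real^4\<close> has index \<open>4 = 0\<close>, so the value
  \<open>(v\<^sub>+, v\<^sub>-, r\<^sub>+, r\<^sub>-)\<close> of \<open>p\<close> has the components \<open>P $ 1, P $ 2, P $ 3, P $ 0\<close>.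
  \<open>N_minus\<close> and \<open>N_plus\<close> recover \<open>|q\<^sub>1|\<^sup>2\<close> and \<open>|Q\<^sub>3|\<^sup>2\<close>, and \<open>rec_d\<close> recovers the \<open>i\<close>-component
  of \<open>ka - mb\<close>.\<close>

definition N_minus :: "real^4 \<Rightarrow> real" where "N_minus P = P$2 + (P$0 / 2)\<^sup>2"
definition N_plus :: "real^4 \<Rightarrow> real" where "N_plus P = P$1 + (P$3 / 2)\<^sup>2"
definition rec_s :: "real \<Rightarrow> real \<Rightarrow> real^4 \<Rightarrow> real" where
  "rec_s k m P = (1 + (N_minus P - N_plus P) / (k\<^sup>2 - m\<^sup>2)) / 2"
definition rec_c :: "real \<Rightarrow> real \<Rightarrow> real^4 \<Rightarrow> real" where
  "rec_c k m P = (N_minus P - k\<^sup>2 * (rec_s k m P)\<^sup>2 - m\<^sup>2 * (1 - rec_s k m P)\<^sup>2) /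
     (2 * k * m * rec_s k m P * (1 - rec_s k m P))"
definition rec_d :: "real \<Rightarrow> real \<Rightarrow> real^4 \<Rightarrow> real" where
  "rec_d k m P = diff_norm2 k m (rec_c k m P) * (P$3 - P$0) / (2 * (k\<^sup>2 - m\<^sup>2))"
definition rec_a :: "real \<Rightarrow> real \<Rightarrow> real^4 \<Rightarrow> real" where
  "rec_a k m P = ((1 - rec_s k m P) * rec_d k m P - P$0 / 2) / k"
definition rec_b :: "real \<Rightarrow> real \<Rightarrow> real^4 \<Rightarrow> real" where
  "rec_b k m P = (- (P$0 / 2) - rec_s k m P * rec_d k m P) / m"

lemma N_p_formula:
  "N_minus (p_formula k m s a b c) = k\<^sup>2 * s\<^sup>2 + m\<^sup>2 * (1 - s)\<^sup>2 + 2 * k * m * s * (1 - s) * c"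
  "N_plus (p_formula k m s a b c) = k\<^sup>2 * (1 - s)\<^sup>2 + m\<^sup>2 * s\<^sup>2 + 2 * k * m * s * (1 - s) * c"
proof -
  have "(2 * x / 2)\<^sup>2 = x\<^sup>2" "(- 2 * x / 2)\<^sup>2 = x\<^sup>2" for x :: real by simp_all
  note half = this
  show "N_minus (p_formula k m s a b c) = k\<^sup>2 * s\<^sup>2 + m\<^sup>2 * (1 - s)\<^sup>2 + 2 * k * m * s * (1 - s) * c"
    "N_plus (p_formula k m s a b c) = k\<^sup>2 * (1 - s)\<^sup>2 + m\<^sup>2 * s\<^sup>2 + 2 * k * m * s * (1 - s) * c"
    unfolding N_minus_def N_plus_def p_formula_def Let_def vector_4_nth half by simp_all
qed

text \<open>The parameters are recovered in the order s, c, d = ka - mb, and then a, b. The last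
  step inverts the linear system for ka and mb given by d and \<open>\<rho>\<close>: ka = (1 - s)d +
  \<open>\<rho>\<close> and mb = \<open>\<rho>\<close> - sd.\<close>

lemma rec_p_formula:
  assumes "k \<noteq> 0" "m \<noteq> 0" "k\<^sup>2 \<noteq> m\<^sup>2" "0 < s" "s < 1" "diff_norm2 k m c > 0"
  shows "rec_s k m (p_formula k m s a b c) = s" "rec_c k m (p_formula k m s a b c) = c"
    "rec_a k m (p_formula k m s a b c) = a" "rec_b k m (p_formula k m s a b c) = b"
proof -
  define \<rho> where "\<rho> = k * s * a + m * (1 - s) * b"
  define l where "l = (k\<^sup>2 - m\<^sup>2) / diff_norm2 k m c"
  define \<sigma> where "\<sigma> = l * (k * a - m * b) - \<rho>"
  let ?P = "p_formula k m s a b c"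
  have P: "?P = vector [k\<^sup>2 * (1 - s)\<^sup>2 + m\<^sup>2 * s\<^sup>2 + 2 * k * m * s * (1 - s) * c - \<sigma>\<^sup>2,
     k\<^sup>2 * s\<^sup>2 + m\<^sup>2 * (1 - s)\<^sup>2 + 2 * k * m * s * (1 - s) * c - \<rho>\<^sup>2, 2 * \<sigma>, - 2 * \<rho>]"
    unfolding p_formula_def Let_def \<sigma>_def l_def \<rho>_def ..
  note N = N_p_formula[of k m s a b c]
  have "N_minus ?P - N_plus ?P = (2 * s - 1) * (k\<^sup>2 - m\<^sup>2)"
    unfolding N by (simp add: power2_eq_square algebra_simps)
  then show s: "rec_s k m ?P = s" using assms by (simp add: rec_s_def)
  have "2 * k * m * s * (1 - s) \<noteq> 0" using assms by simp
  then show c: "rec_c k m ?P = c" unfolding rec_c_def s N by simp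
  have P': "?P $ 3 = 2 * \<sigma>" "?P $ 0 = - 2 * \<rho>"
    unfolding P vector_4_nth by simp_all
  have "diff_norm2 k m c * (2 * \<sigma> - - 2 * \<rho>) = (k * a - m * b) * (2 * (k\<^sup>2 - m\<^sup>2))"
    unfolding \<sigma>_def l_def using assms by simp
  then have d: "rec_d k m ?P = k * a - m * b"
    unfolding rec_d_def c P' using assms by simp
  have "(1 - s) * (k * a - m * b) + \<rho> = k * a" "\<rho> - s * (k * a - m * b) = m * b"
    by (simp_all add: \<rho>_def algebra_simps)
  then show "rec_a k m ?P = a" "rec_b k m ?P = b"
    unfolding rec_a_def rec_b_def s d P' using assms by simp_all
qed

section \<open>Orbits\<close>

definition rot :: "real \<Rightarrow> real \<Rightarrow> complex^4 \<Rightarrow> complex^4" where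
  "rot \<theta> \<phi> Z = vec4 (cis \<theta> * Z$0) (cis (- \<theta>) * Z$1) (cis \<phi> * Z$2) (cis (- \<phi>) * Z$3)"

definition pi_F :: "complex^4 \<Rightarrow> (complex^4) set set" where "pi_F Z = orb (cls Z)"

definition conj_vec :: "complex^4 \<Rightarrow> complex^4" where "conj_vec Z = (\<chi> a. cnj (Z $ a))"

text \<open>For nonzero Z this is the value of \<open>nu\<close> up to the factor
  \<open>12 / norm Z ^ 4\<close>, which is positive and affects neither zeros nor signs.\<close>

definition nu_poly :: "complex^4 \<Rightarrow> real" where
  "nu_poly Z = Im (Z $ 0 * Z $ 1 * cnj (Z $ 2) * cnj (Z $ 3))"

lemma conj_vec_nth [simp]: "conj_vec Z $ i = cnj (Z $ i)"
  by (simp add: conj_vec_def)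

lemma cp_act_T2:
  "cp_act (diag2 (Quat (cis \<theta>) 0) (Quat (cis \<phi>) 0)) (cls Z) = cls (rot \<theta> \<phi> Z)"
proof -
  have "diag2 (Quat (cis \<theta>) 0) (Quat (cis \<phi>) 0) *v hvec (c *s Z) = hvec (c *s rot \<theta> \<phi> Z)" for c
    by (simp add: vec_eq_iff forall_2 matrix_vector_mult_2 rot_def) (simp add: quat_defs cis_cnj)
  then show ?thesis
    unfolding cp_act_def by (auto simp: cls_def hvec_eq_iff)
qed

lemma orb_cls: "orb (cls Z) = {cls (rot \<theta> \<phi> Z) | \<theta> \<phi>. True}"
  unfolding orb_def T2_def cp_act_T2[symmetric] by blast

lemma rot_rot: "rot \<theta> \<phi> (rot \<theta>' \<phi>' Z) = rot (\<theta> + \<theta>') (\<phi> + \<phi>') Z"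
  by (simp add: rot_def vec4_eq_iff mult.assoc[symmetric] cis_mult)

lemma rot_0 [simp]: "rot 0 0 Z = Z"
  by (simp add: rot_def vec4_eq_iff)

lemma pi_F_rot: "pi_F (rot \<theta> \<phi> Z) = pi_F Z"
  unfolding pi_F_def orb_cls rot_rot
  by (auto intro: exI[of _ "_ + \<theta>"]) (metis diff_add_cancel)

lemma pi_F_smult: "c \<noteq> 0 \<Longrightarrow> pi_F (c *s Z) = pi_F Z"
  by (simp add: pi_F_def cls_smult)

lemma pi_F_memD:
  assumes "cls W \<in> pi_F Z"
  obtains c \<theta> \<phi> where "c \<noteq> 0" "W = c *s rot \<theta> \<phi> Z"
proof -
  from assms obtain \<theta> \<phi> where "cls W = cls (rot \<theta> \<phi> Z)" by (auto simp: pi_F_def orb_cls)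
  then have "W \<in> cls (rot \<theta> \<phi> Z)" using cls_refl[of W] by simp
  then show ?thesis using that by (auto simp: cls_def)
qed

lemma cls_in_pi_F: "cls Z \<in> pi_F Z"
  unfolding pi_F_def orb_cls by (auto intro!: exI[of _ "0::real"])

lemma pi_F_eqD:
  assumes "pi_F W = pi_F Z"
  obtains c \<theta> \<phi> where "c \<noteq> 0" "W = c *s rot \<theta> \<phi> Z"
  using assms cls_in_pi_F[of W] by (metis pi_F_memD)

text \<open>Dividing all phases by a square root \<open>\<mu>\<close> of the common product leaves
  two pairs of mutually inverse phases, which a torus element supplies; \<open>\<mu>\<close> itself
  is a projective scalar.\<close>

lemma pi_F_phases:
  assumes u: "cmod u0 = 1" "cmod u1 = 1" "cmod u2 = 1" "cmod u3 = 1" "u0 * u1 = u2 * u3"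
    and W: "W$0 = u0 * Z$0" "W$1 = u1 * Z$1" "W$2 = u2 * Z$2" "W$3 = u3 * Z$3"
  shows "pi_F W = pi_F Z"
proof -
  define \<mu> where "\<mu> = csqrt (u0 * u1)"
  have \<mu>2: "\<mu> * \<mu> = u0 * u1" unfolding \<mu>_def by (metis power2_csqrt power2_eq_square)
  then have "cmod \<mu> * cmod \<mu> = 1" using u by (metis norm_mult mult_1)
  then have \<mu>1: "cmod \<mu> = 1" by (metis norm_ge_zero real_sqrt_abs2 abs_of_nonneg real_sqrt_one)
  then have \<mu>0: "\<mu> \<noteq> 0" by auto
  have cis: "\<exists>t. v = \<mu> * cis t \<and> v' = \<mu> * cis (- t)"
    if "cmod v = 1" "v * v' = \<mu> * \<mu>" for v v'
  proof -
    have "cmod (v / \<mu>) = 1" using that \<mu>1 by (simp add: norm_divide)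
    then obtain t where t: "v / \<mu> = cis t" using complex_unimodular_polar
      by (metis cis_conv_exp complex_norm_eq_1_exp)
    then have v: "v = \<mu> * cis t" using \<mu>0 by (simp add: field_simps)
    then have "cis t * v' = \<mu>" using that(2) \<mu>0 by simp
    then have "cis (- t) * (cis t * v') = cis (- t) * \<mu>" by simp
    then have "v' = \<mu> * cis (- t)" by (simp add: mult.assoc[symmetric] cis_mult)
    with v show ?thesis by blast
  qed
  obtain \<theta> \<phi> where "u0 = \<mu> * cis \<theta>" "u1 = \<mu> * cis (- \<theta>)" "u2 = \<mu> * cis \<phi>" "u3 = \<mu> * cis (- \<phi>)"
    using cis[of u0 u1] cis[of u2 u3] u \<mu>2 by metis
  then have "W = \<mu> *s rot \<theta> \<phi> Z"
    by (simp add: vec4_eq_iff rot_def W)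
  then show ?thesis using \<mu>0 by (simp add: pi_F_smult pi_F_rot)
qed

section \<open>Invariance under the torus and under scaling\<close>

lemma cmod_rot: "cmod (rot \<theta> \<phi> Z $ 0) = cmod (Z$0)" "cmod (rot \<theta> \<phi> Z $ 1) = cmod (Z$1)"
    "cmod (rot \<theta> \<phi> Z $ 2) = cmod (Z$2)" "cmod (rot \<theta> \<phi> Z $ 3) = cmod (Z$3)"
  by (simp_all add: rot_def norm_mult)

lemma rot_prod: "rot \<theta> \<phi> Z $ 0 * rot \<theta> \<phi> Z $ 1 = Z$0 * Z$1" "rot \<theta> \<phi> Z $ 2 * rot \<theta> \<phi> Z $ 3 = Z$2 * Z$3"
  using cis_mult[of \<theta> "- \<theta>"] cis_mult[of \<phi> "- \<phi>"] by (simp_all add: rot_def)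

lemma h_norm2_rot: "h1_norm2 (rot \<theta> \<phi> Z) = h1_norm2 Z" "h2_norm2 (rot \<theta> \<phi> Z) = h2_norm2 Z"
  by (simp_all add: h1_norm2_def h2_norm2_def cmod_rot)

lemma invariants_rot: "s_inv (rot \<theta> \<phi> Z) = s_inv Z" "alpha (rot \<theta> \<phi> Z) = alpha Z" "beta (rot \<theta> \<phi> Z) = beta Z"
    "cos_ab (rot \<theta> \<phi> Z) = cos_ab Z"
  by (simp_all add: s_inv_def alpha_def beta_def cos_ab_def a_J_def b_J_def h_norm2_rot cmod_rot rot_prod mult.assoc)

lemma nu_poly_rot: "nu_poly (rot \<theta> \<phi> Z) = nu_poly Z"
  using rot_prod[of \<theta> \<phi> Z] unfolding nu_poly_def mult.assoc complex_cnj_mult[symmetric] by (simp flip: mult.assoc)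

lemma nu_poly_smult: "nu_poly (c *s Z) = cmod c ^ 4 * nu_poly Z"
proof -
  have "c * c * cnj c * cnj c = of_real (cmod c ^ 4)"
  proof -
    have "c * c * cnj c * cnj c = (c * cnj c) * (c * cnj c)" by (simp add: mult_ac)
    also have "\<dots> = of_real ((cmod c)\<^sup>2 * (cmod c)\<^sup>2)" by (simp only: complex_norm_square of_real_mult)
    finally show ?thesis by (simp flip: power_add)
  qed
  then have "(c *s Z) $ 0 * (c *s Z) $ 1 * cnj ((c *s Z) $ 2) * cnj ((c *s Z) $ 3)
    = of_real (cmod c ^ 4) * (Z $ 0 * Z $ 1 * cnj (Z $ 2) * cnj (Z $ 3))"
    by (simp add: mult_ac)
  moreover have "Im (of_real r * z) = r * Im z" for r z by simp
  ultimately show ?thesis unfolding nu_poly_def by (simp only:)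
qed

text \<open>The representatives differ by a torus element and a scalar c. The latter multiplies
  \<open>nu_poly\<close> by |c|^4, so only its sign is an orbit invariant.\<close>

lemma pi_F_invariants:
  assumes "pi_F W = pi_F Z"
  shows "s_inv W = s_inv Z" "alpha W = alpha Z" "beta W = beta Z" "cos_ab W = cos_ab Z"
    "sgn (nu_poly W) = sgn (nu_poly Z)" "W \<in> regular_vecs \<longleftrightarrow> Z \<in> regular_vecs"
proof -
  obtain c \<theta> \<phi> where c: "c \<noteq> 0" and W: "W = c *s rot \<theta> \<phi> Z" using pi_F_eqD[OF assms] .
  show "s_inv W = s_inv Z" "alpha W = alpha Z" "beta W = beta Z" "cos_ab W = cos_ab Z"
    unfolding W invariants_smult[OF c] invariants_rot by simp_all
  show "sgn (nu_poly W) = sgn (nu_poly Z)"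
    unfolding W nu_poly_smult nu_poly_rot using c by (simp add: sgn_mult)
  show "W \<in> regular_vecs \<longleftrightarrow> Z \<in> regular_vecs" unfolding W regular_vecs_iff using c by (simp add: rot_def)
qed

section \<open>Complex conjugation on orbits\<close>

lemma delta_cls: "delta (cls Z) = cls (conj_vec Z)"
proof -
  have "conj_vec (c *s Z) = cnj c *s conj_vec Z" for c by (simp add: vec_eq_iff)
  then show ?thesis
    unfolding delta_def cls_def conj_vec_def[symmetric]
    by (auto simp: image_iff) (metis complex_cnj_cnj complex_cnj_zero_iff)
qed

lemma conj_vec_rot: "conj_vec (rot \<theta> \<phi> Z) = rot (- \<theta>) (- \<phi>) (conj_vec Z)"
  by (simp add: vec4_eq_iff rot_def cis_cnj)

lemma delta_pi_F: "delta_F (pi_F Z) = pi_F (conj_vec Z)"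
proof -
  have "delta (cls (rot \<theta> \<phi> Z)) = cls (rot (- \<theta>) (- \<phi>) (conj_vec Z))" for \<theta> \<phi>
    by (simp add: delta_cls conj_vec_rot)
  moreover from this have "cls (rot \<theta> \<phi> (conj_vec Z)) = delta (cls (rot (- \<theta>) (- \<phi>) Z))" for \<theta> \<phi>
    by simp
  ultimately show ?thesis
    unfolding delta_F_def pi_F_def orb_cls by blast
qed

lemma pi_F_conj_vec: "pi_F W = pi_F Z \<Longrightarrow> pi_F (conj_vec W) = pi_F (conj_vec Z)"
  by (metis delta_pi_F)

lemma nu_poly_conj_vec: "nu_poly (conj_vec Z) = - nu_poly Z"
proof -
  have "conj_vec Z $ 0 * conj_vec Z $ 1 * cnj (conj_vec Z $ 2) * cnj (conj_vec Z $ 3) = cnj (Z $ 0 * Z $ 1 * cnj (Z $ 2) * cnj (Z $ 3))"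
    by simp
  then show ?thesis unfolding nu_poly_def by (simp only: cnj.simps)
qed

lemma invariants_conj_vec: "s_inv (conj_vec Z) = s_inv Z" "alpha (conj_vec Z) = alpha Z" "beta (conj_vec Z) = beta Z" "cos_ab (conj_vec Z) = cos_ab Z"
  "conj_vec Z \<in> regular_vecs \<longleftrightarrow> Z \<in> regular_vecs"
proof -
  have n: "h1_norm2 (conj_vec Z) = h1_norm2 Z" "h2_norm2 (conj_vec Z) = h2_norm2 Z" by (simp_all add: h1_norm2_def h2_norm2_def)
  show "s_inv (conj_vec Z) = s_inv Z" "alpha (conj_vec Z) = alpha Z" "beta (conj_vec Z) = beta Z" "conj_vec Z \<in> regular_vecs \<longleftrightarrow> Z \<in> regular_vecs"
    by (simp_all add: s_inv_def alpha_def beta_def n regular_vecs_iff)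
  moreover have "a_J (conj_vec Z) = cnj (a_J Z)" "b_J (conj_vec Z) = cnj (b_J Z)"
    by (simp_all add: a_J_def b_J_def n)
  ultimately show "cos_ab (conj_vec Z) = cos_ab Z" by (simp add: cos_ab_def)
qed

lemma conj_vec_conj_vec [simp]: "conj_vec (conj_vec Z) = Z"
  by (simp add: vec_eq_iff)

section \<open>Canonical representatives\<close>

text \<open>The moduli are those of a unit vector with invariants s, a, b. Torus and scalars remove
  all phases but one, which is placed on the last coordinate.\<close>

definition canonical_vec :: "real \<Rightarrow> real \<Rightarrow> real \<Rightarrow> complex \<Rightarrow> complex^4" where
  "canonical_vec s a b \<zeta> = vec4 (of_real (sqrt (s * (1 + a) / 2))) (of_real (sqrt (s * (1 - a) / 2)))
     (of_real (sqrt ((1 - s) * (1 + b) / 2))) (of_real (sqrt ((1 - s) * (1 - b) / 2)) * \<zeta>)"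

lemma alpha_beta_bounds:
  assumes "h1_norm2 Z > 0" "h2_norm2 Z > 0" shows "(alpha Z)\<^sup>2 \<le> 1" "(beta Z)\<^sup>2 \<le> 1"
  using sphere_a[OF assms(1)] sphere_b[OF assms(2)] zero_le_power2[of "cmod (a_J Z)"] zero_le_power2[of "cmod (b_J Z)"]
  by linarith+

lemma canonical_vec_exists:
  assumes "h1_norm2 Z > 0" "h2_norm2 Z > 0"
  obtains \<zeta> where "cmod \<zeta> = 1" "pi_F Z = pi_F (canonical_vec (s_inv Z) (alpha Z) (beta Z) \<zeta>)"
proof -
  \<comment> \<open>A vanishing coordinate receives the phase 1.\<close>
  have ex: "\<exists>u. cmod u = 1 \<and> z = u * of_real (cmod z)" for z :: complex
  proof (cases "z = 0")
    case False
    then show ?thesis by (intro exI[of _ "sgn z"]) (simp add: sgn_eq norm_divide)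
  qed (auto intro: exI[of _ 1])
  obtain u0 u1 u2 u3 where u: "cmod u0 = 1" "cmod u1 = 1" "cmod u2 = 1" "cmod u3 = 1"
    and Z: "Z$0 = u0 * of_real (cmod (Z$0))" "Z$1 = u1 * of_real (cmod (Z$1))"
     "Z$2 = u2 * of_real (cmod (Z$2))" "Z$3 = u3 * of_real (cmod (Z$3))"
    using ex by metis
  have u0: "u0 \<noteq> 0" "u1 \<noteq> 0" "u2 \<noteq> 0" "u3 \<noteq> 0" using u by auto
  \<comment> \<open>This combination of the phases is unchanged by the torus and by scalars. It is
    chosen so that u0, u1, u2 and u3 / \<open>\<zeta>\<close> meet the condition of
    \<open>pi_F_phases\<close>.\<close>
  define \<zeta> where "\<zeta> = u2 * u3 / (u0 * u1)"
  define n where "n = h1_norm2 Z + h2_norm2 Z"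
  have n: "n > 0" using assms by (simp add: n_def)
  have \<zeta>: "cmod \<zeta> = 1" by (simp add: \<zeta>_def norm_mult norm_divide u)
  have t: "1 - s_inv Z = h2_norm2 Z / n" using n by (simp add: s_inv_def n_def field_simps)
  have "s_inv Z * (1 + alpha Z) / 2 = (cmod (Z$0))\<^sup>2 / n" "s_inv Z * (1 - alpha Z) / 2 = (cmod (Z$1))\<^sup>2 / n"
    using assms n by (simp_all add: s_inv_def alpha_def n_def[symmetric] field_simps)
      (simp_all add: h1_norm2_def algebra_simps)
  moreover have "(1 - s_inv Z) * (1 + beta Z) / 2 = (cmod (Z$2))\<^sup>2 / n" "(1 - s_inv Z) * (1 - beta Z) / 2 = (cmod (Z$3))\<^sup>2 / n"
    unfolding t using assms n by (simp_all add: beta_def field_simps)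
      (simp_all add: h2_norm2_def algebra_simps)
  ultimately have C: "of_real (sqrt n) *s canonical_vec (s_inv Z) (alpha Z) (beta Z) \<zeta> =
      vec4 (of_real (cmod (Z$0))) (of_real (cmod (Z$1))) (of_real (cmod (Z$2))) (of_real (cmod (Z$3)) * \<zeta>)"
    using n by (simp add: canonical_vec_def vec4_eq_iff real_sqrt_divide)
  have "pi_F Z = pi_F (of_real (sqrt n) *s canonical_vec (s_inv Z) (alpha Z) (beta Z) \<zeta>)"
    unfolding C
    by (rule pi_F_phases[of u0 u1 u2 "u3 / \<zeta>"])
      (use u \<zeta> u0 in \<open>simp_all add: norm_divide Z[symmetric]\<close>, simp_all add: \<zeta>_def Z[symmetric] field_simps)
  also have "\<dots> = pi_F (canonical_vec (s_inv Z) (alpha Z) (beta Z) \<zeta>)"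
    by (rule pi_F_smult) (use n in simp)
  finally show ?thesis using that \<zeta> by blast
qed

text \<open>On these vectors \<open>a_J\<close> is real and nonnegative and \<open>\<zeta>\<close>
  is the phase of \<open>b_J\<close>. Hence \<open>cos_ab\<close> sees the real part of
  \<open>\<zeta>\<close> and \<open>nu_poly\<close> the imaginary part.\<close>

lemma canonical_vec_invariants:
  assumes s: "0 < s" "s < 1" and ab: "a\<^sup>2 \<le> 1" "b\<^sup>2 \<le> 1" and \<zeta>: "cmod \<zeta> = 1"
  shows "h1_norm2 (canonical_vec s a b \<zeta>) = s" "h2_norm2 (canonical_vec s a b \<zeta>) = 1 - s"
    "s_inv (canonical_vec s a b \<zeta>) = s" "alpha (canonical_vec s a b \<zeta>) = a" "beta (canonical_vec s a b \<zeta>) = b"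
    "cos_ab (canonical_vec s a b \<zeta>) = a * b + sqrt (1 - a\<^sup>2) * sqrt (1 - b\<^sup>2) * Re \<zeta>"
    "nu_poly (canonical_vec s a b \<zeta>) = - (s * (1 - s) / 4 * (sqrt (1 - a\<^sup>2) * sqrt (1 - b\<^sup>2)) * Im \<zeta>)"
proof -
  have ab': "\<bar>a\<bar> \<le> 1" "\<bar>b\<bar> \<le> 1" using ab by (simp_all add: abs_square_le_1)
  define Z where "Z = canonical_vec s a b \<zeta>"
  have nn: "0 \<le> s * (1 + a) / 2" "0 \<le> s * (1 - a) / 2" "0 \<le> (1 - s) * (1 + b) / 2" "0 \<le> (1 - s) * (1 - b) / 2"
    using s ab' by auto
  have Z2: "(cmod (Z$0))\<^sup>2 = s * (1 + a) / 2" "(cmod (Z$1))\<^sup>2 = s * (1 - a) / 2"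
     "(cmod (Z$2))\<^sup>2 = (1 - s) * (1 + b) / 2" "(cmod (Z$3))\<^sup>2 = (1 - s) * (1 - b) / 2"
    unfolding Z_def canonical_vec_def vec4_nth norm_mult norm_of_real \<zeta> power_mult_distrib power2_abs
      real_sqrt_pow2[OF nn(1)] real_sqrt_pow2[OF nn(2)] real_sqrt_pow2[OF nn(3)] real_sqrt_pow2[OF nn(4)] by simp_all
  show n: "h1_norm2 (canonical_vec s a b \<zeta>) = s" "h2_norm2 (canonical_vec s a b \<zeta>) = 1 - s"
    unfolding Z_def[symmetric] h1_norm2_def h2_norm2_def Z2 by (simp_all add: field_simps)
  show "s_inv (canonical_vec s a b \<zeta>) = s" by (simp add: s_inv_def n)
  show alpha: "alpha (canonical_vec s a b \<zeta>) = a" and beta: "beta (canonical_vec s a b \<zeta>) = b"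
    unfolding alpha_def beta_def n unfolding Z_def[symmetric] Z2 using s by (simp_all add: field_simps)
  have "s * (1 + a) / 2 * (s * (1 - a) / 2) = (s / 2)\<^sup>2 * (1 - a\<^sup>2)"
     "(1 - s) * (1 + b) / 2 * ((1 - s) * (1 - b) / 2) = ((1 - s) / 2)\<^sup>2 * (1 - b\<^sup>2)"
    by (simp_all add: power2_eq_square field_simps)
  then have p: "Z$0 * Z$1 = of_real (s / 2 * sqrt (1 - a\<^sup>2))" "Z$2 * Z$3 = of_real ((1 - s) / 2 * sqrt (1 - b\<^sup>2)) * \<zeta>"
    unfolding Z_def canonical_vec_def vec4_nth mult.assoc[symmetric] of_real_mult[symmetric] real_sqrt_mult[symmetric]
    using s by (simp_all add: real_sqrt_mult)
  have J: "a_J Z = of_real (sqrt (1 - a\<^sup>2))" "b_J Z = of_real (sqrt (1 - b\<^sup>2)) * \<zeta>"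
    unfolding a_J_def b_J_def mult.assoc p unfolding Z_def n using s by simp_all
  show "cos_ab (canonical_vec s a b \<zeta>) = a * b + sqrt (1 - a\<^sup>2) * sqrt (1 - b\<^sup>2) * Re \<zeta>"
    unfolding cos_ab_def alpha beta unfolding Z_def[symmetric] J by simp
  have "nu_poly Z = Im ((Z$0 * Z$1) * cnj (Z$2 * Z$3))" by (simp add: nu_poly_def mult.assoc)
  then have "nu_poly Z = - (s * (1 - s) / 4 * (sqrt (1 - a\<^sup>2) * sqrt (1 - b\<^sup>2)) * Im \<zeta>)"
    unfolding p by simp
  then show "nu_poly (canonical_vec s a b \<zeta>) = - (s * (1 - s) / 4 * (sqrt (1 - a\<^sup>2) * sqrt (1 - b\<^sup>2)) * Im \<zeta>)"
    by (simp only: Z_def)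
qed

text \<open>One coordinate vanishes, so its phase is free and absorbs the change from one value of
  \<open>\<zeta>\<close> to the other.\<close>

lemma canonical_vec_degenerate:
  assumes "a\<^sup>2 = 1 \<or> b\<^sup>2 = 1" "cmod \<zeta> = 1" "cmod \<zeta>' = 1"
  shows "pi_F (canonical_vec s a b \<zeta>) = pi_F (canonical_vec s a b \<zeta>')"
proof -
  have z: "\<zeta> \<noteq> 0" "\<zeta>' \<noteq> 0" using assms by auto
  define u where "u = \<zeta> / \<zeta>'"
  have u: "cmod u = 1" "u \<noteq> 0" "\<zeta> = u * \<zeta>'" using assms z by (auto simp: u_def norm_divide)
  consider "a = -1" | "a = 1" | "b = -1" | "b = 1" using assms(1) by (auto simp: power2_eq_1_iff)
  then show ?thesis
  proof cases
    case 1 show ?thesis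
      by (rule pi_F_phases[of u 1 1 u]) (use u 1 in \<open>simp_all add: canonical_vec_def\<close>)
  next
    case 2 show ?thesis
      by (rule pi_F_phases[of 1 u 1 u]) (use u 2 in \<open>simp_all add: canonical_vec_def\<close>)
  next
    case 3 show ?thesis
      by (rule pi_F_phases[of 1 1 "1/u" u]) (use u 3 in \<open>simp_all add: canonical_vec_def norm_divide\<close>)
  next
    case 4 show ?thesis
      by (rule pi_F_phases[of 1 1 1 1]) (use u 4 in \<open>simp_all add: canonical_vec_def\<close>)
  qed
qed

lemma canonical_vec_cnj: "canonical_vec s a b (cnj \<zeta>) = conj_vec (canonical_vec s a b \<zeta>)"
  by (simp add: vec4_eq_iff canonical_vec_def)

text \<open>For canonical representatives only \<open>\<zeta>\<close> is left. Unless a or b is an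
  endpoint, \<open>cos_ab\<close> fixes its real part, and modulus 1 leaves \<open>\<zeta>\<close>
  and its conjugate.\<close>

lemma same_invariants_conjugate:
  assumes "Z \<in> regular_vecs" "W \<in> regular_vecs"
    and inv: "s_inv W = s_inv Z" "alpha W = alpha Z" "beta W = beta Z" "cos_ab W = cos_ab Z"
  shows "pi_F W = pi_F Z \<or> pi_F W = pi_F (conj_vec Z)"
proof -
  let ?C = "canonical_vec (s_inv Z) (alpha Z) (beta Z)"
  note pos = h_norm2_pos[OF assms(1)] h_norm2_pos[OF assms(2)]
  obtain \<zeta> where \<zeta>: "cmod \<zeta> = 1" "pi_F Z = pi_F (?C \<zeta>)" using canonical_vec_exists[OF pos(1,2)] .
  obtain \<eta> where \<eta>: "cmod \<eta> = 1" "pi_F W = pi_F (?C \<eta>)" using canonical_vec_exists[OF pos(3,4)] inv by metis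
  note I = canonical_vec_invariants[OF s_bounds[OF assms(1)] alpha_beta_bounds[OF pos(1,2)]]
  show ?thesis
  proof (cases "(alpha Z)\<^sup>2 = 1 \<or> (beta Z)\<^sup>2 = 1")
    case True
    then show ?thesis using canonical_vec_degenerate \<zeta> \<eta> by metis
  next
    case False
    have "cos_ab (?C \<zeta>) = cos_ab (?C \<eta>)" using pi_F_invariants(4)[OF \<zeta>(2)] pi_F_invariants(4)[OF \<eta>(2)] inv by simp
    then have Re: "Re \<zeta> = Re \<eta>" using False by (simp add: I(6)[OF \<zeta>(1)] I(6)[OF \<eta>(1)])
    have "(Re \<zeta>)\<^sup>2 + (Im \<zeta>)\<^sup>2 = (Re \<eta>)\<^sup>2 + (Im \<eta>)\<^sup>2"
      unfolding cmod_power2[symmetric] \<zeta>(1) \<eta>(1) ..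
    then have "(Im \<eta>)\<^sup>2 = (Im \<zeta>)\<^sup>2" using Re by simp
    then have "Im \<eta> = Im \<zeta> \<or> Im \<eta> = - Im \<zeta>" by (simp only: power2_eq_iff)
    then have "\<eta> = \<zeta> \<or> \<eta> = cnj \<zeta>" using Re by (auto simp: complex_eq_iff)
    then show ?thesis using \<zeta>(2) \<eta>(2) canonical_vec_cnj pi_F_conj_vec[OF \<zeta>(2)] by auto
  qed
qed

text \<open>Conjugation reverses the sign of \<open>nu_poly\<close>, which is an orbit invariant.
  Conversely, if it vanishes, either \<open>\<zeta>\<close> is real or the degenerate case makes
  \<open>\<zeta>\<close> irrelevant to the orbit.\<close>

lemma pi_F_conj_vec_eq_iff:
  assumes "Z \<in> regular_vecs"
  shows "pi_F (conj_vec Z) = pi_F Z \<longleftrightarrow> nu_poly Z = 0"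
proof
  assume "pi_F (conj_vec Z) = pi_F Z"
  then have "sgn (nu_poly (conj_vec Z)) = sgn (nu_poly Z)" by (rule pi_F_invariants)
  then show "nu_poly Z = 0" by (simp add: nu_poly_conj_vec sgn_minus sgn_zero_iff)
next
  assume 0: "nu_poly Z = 0"
  let ?C = "canonical_vec (s_inv Z) (alpha Z) (beta Z)"
  note pos = h_norm2_pos[OF assms]
  obtain \<zeta> where \<zeta>: "cmod \<zeta> = 1" "pi_F Z = pi_F (?C \<zeta>)" using canonical_vec_exists[OF pos(1,2)] .
  note I = canonical_vec_invariants[OF s_bounds[OF assms(1)] alpha_beta_bounds[OF pos(1,2)]]
  have "nu_poly (?C \<zeta>) = 0" using pi_F_invariants(5)[OF \<zeta>(2)] 0 by (simp add: sgn_zero_iff)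
  then have "((alpha Z)\<^sup>2 = 1 \<or> (beta Z)\<^sup>2 = 1) \<or> Im \<zeta> = 0"
    using s_bounds[OF assms] by (auto simp: I(7)[OF \<zeta>(1)])
  then have "pi_F (?C (cnj \<zeta>)) = pi_F (?C \<zeta>)"
  proof
    assume "Im \<zeta> = 0" then have "cnj \<zeta> = \<zeta>" by (simp add: complex_eq_iff)
    then show ?thesis by simp
  next
    assume "(alpha Z)\<^sup>2 = 1 \<or> (beta Z)\<^sup>2 = 1"
    then show ?thesis by (rule canonical_vec_degenerate) (simp_all add: \<zeta>(1))
  qed
  then show "pi_F (conj_vec Z) = pi_F Z" using \<zeta>(2) pi_F_conj_vec[OF \<zeta>(2)] canonical_vec_cnj by simp
qed

section \<open>The quotient map onto the orbit space\<close>

lemma regular_vecs_nonzero: "Z \<in> regular_vecs \<Longrightarrow> Z \<noteq> 0"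
  by (auto simp: regular_vecs_iff)

lemma open_regular_vecs: "open regular_vecs"
proof -
  have "regular_vecs = {Z. (Z$0 \<noteq> 0 \<or> Z$1 \<noteq> 0) \<and> (Z$0 \<noteq> 0 \<or> Z$2 \<noteq> 0) \<and> (Z$0 \<noteq> 0 \<or> Z$3 \<noteq> 0)
   \<and> (Z$1 \<noteq> 0 \<or> Z$2 \<noteq> 0) \<and> (Z$1 \<noteq> 0 \<or> Z$3 \<noteq> 0) \<and> (Z$2 \<noteq> 0 \<or> Z$3 \<noteq> 0)}"
    by (simp add: regular_vecs_iff set_eq_iff)
  also have "open \<dots>"
    by (intro open_Collect_conj open_Collect_disj open_Collect_neq continuous_intros)
  finally show ?thesis .
qed

lemma topspace_CP3: "topspace CP3 = cls ` (- {0})"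
  by (simp add: CP3_def topspace_quotient_topology)

lemma cls_eqD: assumes "cls W = cls Z" obtains c where "c \<noteq> 0" "W = c *s Z"
  using assms cls_refl[of W] by (auto simp: cls_def)

lemma cls_sing_iff: assumes "Z \<noteq> 0" shows "cls Z \<in> sing_lines \<longleftrightarrow> Z \<notin> regular_vecs"
proof
  assume "cls Z \<in> sing_lines"
  then obtain W a b where W: "cls Z = cls W" "a \<noteq> b" "W $ a = 0" "W $ b = 0"
    by (auto simp: sing_lines_def)
  obtain c where "Z = c *s W" using cls_eqD[OF W(1)] by metis
  then show "Z \<notin> regular_vecs" using W unfolding regular_vecs_def by auto
next
  assume "Z \<notin> regular_vecs"
  then show "cls Z \<in> sing_lines" using assms unfolding regular_vecs_def sing_lines_def by blast
qed

lemma regular_points: "topspace CP3 - sing_lines = cls ` regular_vecs"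
  unfolding topspace_CP3 using cls_sing_iff regular_vecs_nonzero by (fastforce simp: image_iff)

text \<open>The regular vectors are the full preimage of an open set of projective points, so
  \<open>cls\<close> restricts to a quotient map there; composing with \<open>orb\<close> gives
  \<open>pi_F\<close>.\<close>

lemma quotient_map_pi_F: "quotient_map (top_of_set regular_vecs) M_F pi_F"
proof -
  have pre: "{Z \<in> - {0}. cls Z \<in> cls ` regular_vecs} = regular_vecs"
    unfolding regular_points[symmetric] topspace_CP3 using cls_sing_iff regular_vecs_nonzero by auto
  have "openin CP3 (cls ` regular_vecs)"
    unfolding CP3_def openin_quotient_topology
    using regular_vecs_nonzero pre open_regular_vecs by (auto simp: openin_open)
  moreover have "quotient_map (top_of_set (- {0})) CP3 cls"
    unfolding CP3_def by (rule quotient_map_quotient_topology)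
  ultimately have "quotient_map (subtopology (top_of_set (- {0})) regular_vecs) (subtopology CP3 (cls ` regular_vecs)) cls"
    using pre by (intro quotient_map_restriction) auto
  moreover have "subtopology (top_of_set (- {0})) regular_vecs = top_of_set regular_vecs"
    using regular_vecs_nonzero by (simp add: subtopology_subtopology) (metis Compl_iff Int_absorb1 singletonD subsetI)
  moreover have "quotient_map (subtopology CP3 (cls ` regular_vecs)) M_F orb"
    unfolding M_F_def regular_points by (rule quotient_map_quotient_topology)
  moreover have "pi_F = orb \<circ> cls" by (simp add: fun_eq_iff pi_F_def)
  ultimately show ?thesis by (metis quotient_map_compose)
qed

lemma topspace_M_F: "topspace M_F = pi_F ` regular_vecs"
  using quotient_imp_surjective_map[OF quotient_map_pi_F] by simp

lemma openin_M_F: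
  assumes "S \<subseteq> pi_F ` regular_vecs" shows "openin M_F S \<longleftrightarrow> openin (top_of_set regular_vecs) {Z \<in> regular_vecs. pi_F Z \<in> S}"
  using quotient_map_pi_F assms unfolding quotient_map_def topspace_M_F[symmetric] by simp

lemma nu_cls: assumes "Z \<in> regular_vecs" shows "nu (cls Z) = 0 \<longleftrightarrow> nu_poly Z = 0"
proof -
  define W where "W = (SOME W. W \<in> cls Z)"
  have "W \<in> cls Z" unfolding W_def by (rule someI) (rule cls_refl)
  then obtain c where c: "c \<noteq> 0" "W = c *s Z" by (auto simp: cls_def)
  have "W \<noteq> 0" using c regular_vecs_nonzero[OF assms] by simp
  then have "nu (cls Z) = 0 \<longleftrightarrow> nu_poly W = 0"
    unfolding nu_def Let_def W_def[symmetric] nu_poly_def by simp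
  then show ?thesis using c by (simp add: nu_poly_smult)
qed

lemma branch_set_eq: "branch_set = pi_F ` {Z \<in> regular_vecs. nu_poly Z = 0}"
  unfolding branch_set_def regular_points pi_F_def using nu_cls by (auto simp: image_iff)

lemma pi_F_in_branch: assumes "Z \<in> regular_vecs" shows "pi_F Z \<in> branch_set \<longleftrightarrow> nu_poly Z = 0"
proof
  assume "pi_F Z \<in> branch_set"
  then obtain W where "pi_F Z = pi_F W" "nu_poly W = 0" unfolding branch_set_eq by blast
  then show "nu_poly Z = 0" using pi_F_invariants(5)[of Z W] by (simp add: sgn_zero_iff)
qed (use assms in \<open>auto simp: branch_set_eq\<close>)

section \<open>Continuity of the invariants\<close>

lemma continuous_on_vec4:
  assumes "continuous_on S a" "continuous_on S b" "continuous_on S c" "continuous_on S d"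
  shows "continuous_on S (\<lambda>x. vec4 (a x) (b x) (c x) (d x :: 'b::real_normed_vector))"
  unfolding vec4_def
proof (rule continuous_on_vec_lambda)
  show "continuous_on S (\<lambda>x. if i = 0 then a x else if i = 1 then b x else if i = 2 then c x else d x)" for i :: 4
    using assms by (cases "i = 0"; cases "i = 1"; cases "i = 2") auto
qed

lemma vector_vec4: "vector [a, b, c, d] = vec4 d a b c"
  by (simp add: vec4_eq_iff vector_4_nth)

lemma continuous_on_invariants:
  "continuous_on regular_vecs s_inv" "continuous_on regular_vecs alpha" "continuous_on regular_vecs beta" "continuous_on regular_vecs cos_ab"
proof -
  have n: "continuous_on regular_vecs h1_norm2" "continuous_on regular_vecs h2_norm2"
    unfolding h1_norm2_def h2_norm2_def by (intro continuous_intros)+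
  have nz: "\<forall>Z\<in>regular_vecs. h1_norm2 Z \<noteq> 0" "\<forall>Z\<in>regular_vecs. h2_norm2 Z \<noteq> 0" "\<forall>Z\<in>regular_vecs. h1_norm2 Z + h2_norm2 Z \<noteq> 0"
    "\<forall>Z\<in>regular_vecs. complex_of_real (h1_norm2 Z) \<noteq> 0" "\<forall>Z\<in>regular_vecs. complex_of_real (h2_norm2 Z) \<noteq> 0"
    using h_norm2_pos by (fastforce simp: less_le)+
  show "continuous_on regular_vecs s_inv" unfolding s_inv_def by (intro continuous_intros n nz)
  show alpha: "continuous_on regular_vecs alpha" and beta: "continuous_on regular_vecs beta"
    unfolding alpha_def beta_def by (intro continuous_intros n nz)+
  have "continuous_on regular_vecs a_J" "continuous_on regular_vecs b_J"
    unfolding a_J_def b_J_def by (intro continuous_intros n nz)+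
  then show "continuous_on regular_vecs cos_ab" unfolding cos_ab_def by (intro continuous_intros alpha beta)
qed

section \<open>The branched double cover\<close>

context
  fixes k m :: int
  assumes km: "k \<noteq> 0" "m \<noteq> 0" "k \<noteq> m" "k \<noteq> - m"
begin

private definition "F Z = p_formula k m (s_inv Z) (alpha Z) (beta Z) (cos_ab Z)"

private lemma km': "real_of_int k \<noteq> 0" "real_of_int m \<noteq> 0" "(real_of_int k)\<^sup>2 \<noteq> (real_of_int m)\<^sup>2"
  using km by (auto simp: power2_eq_iff)

private lemma diff_norm2_pos': "Z \<in> regular_vecs \<Longrightarrow> diff_norm2 k m (cos_ab Z) > 0"
  using diff_norm2_pos h_norm2_pos km' by blast

text \<open>The point chosen in the orbit is a torus translate of the class of Z, and the invariants
  do not see the translation.\<close>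

private lemma p_pi_F: assumes "Z \<in> regular_vecs" shows "p_map (xi k m) (pi_F Z) = F Z"
proof -
  define x where "x = (SOME x. x \<in> pi_F Z)"
  have "x \<in> pi_F Z" unfolding x_def by (rule someI) (rule cls_in_pi_F)
  then obtain \<theta> \<phi> where x: "x = cls (rot \<theta> \<phi> Z)" by (auto simp: pi_F_def orb_cls)
  have "p_map (xi k m) (pi_F Z) = vector [v_plus (xi k m) x, v_minus (xi k m) x, r_plus (xi k m) x, r_minus (xi k m) x]"
    by (simp add: p_map_def Let_def x_def)
  also have "\<dots> = F Z"
    unfolding x F_def using functions_eq[of "rot \<theta> \<phi> Z" k m] h_norm2_pos[OF assms] km'(3)
    by (simp add: h_norm2_rot invariants_rot)
  finally show ?thesis .
qed

private lemma rec_F: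
  assumes "Z \<in> regular_vecs"
  shows "rec_s k m (F Z) = s_inv Z" "rec_c k m (F Z) = cos_ab Z" "rec_a k m (F Z) = alpha Z" "rec_b k m (F Z) = beta Z"
  unfolding F_def using rec_p_formula[OF km' s_bounds[OF assms] diff_norm2_pos'[OF assms]] by simp_all

private lemma F_eqD:
  assumes "Z \<in> regular_vecs" "W \<in> regular_vecs" "F W = F Z"
  shows "pi_F W = pi_F Z \<or> pi_F W = pi_F (conj_vec Z)"
  using same_invariants_conjugate[OF assms(1,2)] rec_F[OF assms(1)] rec_F[OF assms(2)] assms(3) by simp

private lemma F_conj_vec: "F (conj_vec Z) = F Z"
  by (simp add: F_def invariants_conj_vec)

private lemma continuous_on_F: "continuous_on regular_vecs F"
proof -
  have nz: "\<forall>Z\<in>regular_vecs. diff_norm2 k m (cos_ab Z) \<noteq> 0" using diff_norm2_pos' by fastforce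
  have d: "continuous_on regular_vecs (\<lambda>Z. diff_norm2 k m (cos_ab Z))"
    unfolding diff_norm2_def by (intro continuous_intros continuous_on_invariants)
  show ?thesis
    unfolding F_def p_formula_def Let_def vector_vec4
    by (intro continuous_on_vec4 continuous_intros continuous_on_invariants d nz)
qed

private lemma continuous_p: "continuous_map M_F euclidean (p_map (xi k m))"
proof -
  have "continuous_map (top_of_set regular_vecs) euclidean (p_map (xi k m) \<circ> pi_F)"
    using continuous_on_F by (simp add: p_pi_F cong: continuous_on_cong)
  then show ?thesis using continuous_compose_quotient_map_eq[OF quotient_map_pi_F] by blast
qed

private lemma image_p: "p_map (xi k m) ` topspace M_F = F ` regular_vecs"
  unfolding topspace_M_F image_image using p_pi_F by (rule image_cong[OF refl])

text \<open>The values of \<open>N_minus\<close> and \<open>N_plus\<close> are |q1|^2 and |Q3|^2,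
  which are at most K = (|k| + |m|)^2. Each is a sum of two nonnegative terms, so both terms are
  bounded by K.\<close>

private lemma bounded_F: "bounded (F ` regular_vecs)"
proof -
  define K where "K = (real_of_int k)\<^sup>2 + (real_of_int m)\<^sup>2 + 2 * \<bar>real_of_int k * real_of_int m\<bar>"
  have "norm (F Z) \<le> K + K + (2 + K) + (2 + K)" if Z: "Z \<in> regular_vecs" for Z
  proof -
    note s = s_bounds[OF Z]
    have sq: "(s_inv Z)\<^sup>2 \<le> 1" "(1 - s_inv Z)\<^sup>2 \<le> 1" using s by (simp_all add: abs_square_le_1)
    have "\<bar>s_inv Z * (1 - s_inv Z) * cos_ab Z\<bar> \<le> 1 * 1 * 1"
      unfolding abs_mult using s cos_ab_abs_le_1[OF h_norm2_pos[OF Z]] by (intro mult_mono) auto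
    then have "\<bar>real_of_int k * real_of_int m\<bar> * \<bar>s_inv Z * (1 - s_inv Z) * cos_ab Z\<bar> \<le> \<bar>real_of_int k * real_of_int m\<bar> * 1"
      by (intro mult_left_mono) auto
    then have "2 * real_of_int k * real_of_int m * s_inv Z * (1 - s_inv Z) * cos_ab Z \<le> 2 * \<bar>real_of_int k * real_of_int m\<bar>"
      unfolding abs_mult[symmetric] by (simp add: mult.assoc)
    moreover have "(real_of_int j)\<^sup>2 * (s_inv Z)\<^sup>2 \<le> (real_of_int j)\<^sup>2"
      "(real_of_int j)\<^sup>2 * (1 - s_inv Z)\<^sup>2 \<le> (real_of_int j)\<^sup>2" for j
      by (simp_all only: mult_left_le[OF sq(1)] mult_left_le[OF sq(2)] zero_le_power2)
    note this[of k] this[of m]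
    ultimately have "N_minus (F Z) \<le> K" "N_plus (F Z) \<le> K"
      unfolding F_def N_p_formula K_def by - (linarith+)
    then have N: "F Z $ 2 + (F Z $ 0 / 2)\<^sup>2 \<le> K" "F Z $ 1 + (F Z $ 3 / 2)\<^sup>2 \<le> K"
      by (simp_all add: N_minus_def N_plus_def)
    \<comment> \<open>The sign is not visible in \<open>p_formula\<close>; it comes from the
      definition of the components as squared moduli.\<close>
    have v: "F Z $ 1 \<ge> 0" "F Z $ 2 \<ge> 0"
      unfolding p_pi_F[OF Z, symmetric] p_map_def Let_def vector_4_nth v_plus_def v_minus_def by simp_all
    have r: "\<bar>x\<bar> \<le> 2 + K" if "(x / 2)\<^sup>2 \<le> K" for x :: real
    proof -
      have "0 \<le> (\<bar>x / 2\<bar> - 1)\<^sup>2" by simp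
      then have "2 * \<bar>x / 2\<bar> \<le> 1 + (x / 2)\<^sup>2" by (simp add: power2_diff power_divide)
      then show ?thesis using that by simp
    qed
    have "\<bar>F Z $ 1\<bar> \<le> K" "\<bar>F Z $ 2\<bar> \<le> K" "(F Z $ 0 / 2)\<^sup>2 \<le> K" "(F Z $ 3 / 2)\<^sup>2 \<le> K"
      using N v zero_le_power2[of "F Z $ 0 / 2"] zero_le_power2[of "F Z $ 3 / 2"] by linarith+
    moreover have "norm (F Z) \<le> \<bar>F Z $ 0\<bar> + \<bar>F Z $ 1\<bar> + \<bar>F Z $ 2\<bar> + \<bar>F Z $ 3\<bar>"
      using norm_le_l1_cart[of "F Z"] unfolding UNIV_4_zero by simp
    ultimately show ?thesis using r[of "F Z $ 0"] r[of "F Z $ 3"] by linarith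
  qed
  then show ?thesis unfolding bounded_iff by blast
qed

section \<open>Sheets and their sections\<close>

private definition "sheet \<epsilon> = pi_F ` {Z \<in> regular_vecs. sgn (nu_poly Z) = \<epsilon>}"

text \<open>The real part of \<open>\<zeta>\<close> in the canonical representative, solved from the
  expression for \<open>cos_ab\<close>.\<close>

private definition "cos_phase P = (rec_c k m P - rec_a k m P * rec_b k m P) /
   (sqrt (1 - (rec_a k m P)\<^sup>2) * sqrt (1 - (rec_b k m P)\<^sup>2))"

text \<open>The sign is reversed because the last coordinate enters \<open>nu_poly\<close> conjugated.\<close>

private definition "sec \<epsilon> P = canonical_vec (rec_s k m P) (rec_a k m P) (rec_b k m P)
   (of_real (cos_phase P) - \<i> * of_real (\<epsilon> * sqrt (1 - (cos_phase P)\<^sup>2)))"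

private definition "D' = F ` {Z \<in> regular_vecs. nu_poly Z \<noteq> 0}"

text \<open>On the canonical representative \<open>nu_poly\<close> is a product containing sqrt(1 -
  a^2), sqrt(1 - b^2) and Im \<open>\<zeta>\<close>, so none of these vanishes.\<close>

private lemma nondegenerate:
  assumes Z: "Z \<in> regular_vecs" "nu_poly Z \<noteq> 0"
  shows "(alpha Z)\<^sup>2 < 1" "(beta Z)\<^sup>2 < 1" "(cos_phase (F Z))\<^sup>2 < 1"
    "cos_ab Z = alpha Z * beta Z + sqrt (1 - (alpha Z)\<^sup>2) * sqrt (1 - (beta Z)\<^sup>2) * cos_phase (F Z)"
proof -
  note pos = h_norm2_pos[OF Z(1)]
  obtain \<zeta> where \<zeta>: "cmod \<zeta> = 1" "pi_F Z = pi_F (canonical_vec (s_inv Z) (alpha Z) (beta Z) \<zeta>)"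
    using canonical_vec_exists[OF pos] .
  note I = canonical_vec_invariants[OF s_bounds[OF Z(1)] alpha_beta_bounds[OF pos] \<zeta>(1)]
  have "nu_poly (canonical_vec (s_inv Z) (alpha Z) (beta Z) \<zeta>) \<noteq> 0"
    using pi_F_invariants(5)[OF \<zeta>(2)] Z(2) by (metis sgn_zero_iff)
  then have nz: "(alpha Z)\<^sup>2 \<noteq> 1" "(beta Z)\<^sup>2 \<noteq> 1" "Im \<zeta> \<noteq> 0" unfolding I(7) by auto
  then show ab: "(alpha Z)\<^sup>2 < 1" "(beta Z)\<^sup>2 < 1" using alpha_beta_bounds[OF pos] by auto
  have c: "cos_ab Z = alpha Z * beta Z + sqrt (1 - (alpha Z)\<^sup>2) * sqrt (1 - (beta Z)\<^sup>2) * Re \<zeta>"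
    using pi_F_invariants(4)[OF \<zeta>(2)] I(6) by simp
  then have cz: "cos_phase (F Z) = Re \<zeta>"
    unfolding cos_phase_def rec_F[OF Z(1)] using nz by simp
  have "(Re \<zeta>)\<^sup>2 + (Im \<zeta>)\<^sup>2 = 1" using \<zeta>(1) by (simp flip: cmod_power2)
  moreover have "(Im \<zeta>)\<^sup>2 > 0" using nz(3) by simp
  ultimately show "(cos_phase (F Z))\<^sup>2 < 1" unfolding cz by linarith
  show "cos_ab Z = alpha Z * beta Z + sqrt (1 - (alpha Z)\<^sup>2) * sqrt (1 - (beta Z)\<^sup>2) * cos_phase (F Z)"
    unfolding cz by (rule c)
qed

text \<open>The phase built from \<open>cos_phase P\<close> has modulus 1 and the real part dictated
  by P. The section therefore has the invariants encoded in P, and \<open>F\<close> depends on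
  nothing else.\<close>

private lemma sec_works:
  assumes P: "P \<in> D'" and \<epsilon>: "\<epsilon> = 1 \<or> \<epsilon> = - 1"
  shows "sec \<epsilon> P \<in> regular_vecs" "F (sec \<epsilon> P) = P" "sgn (nu_poly (sec \<epsilon> P)) = \<epsilon>"
proof -
  obtain Z where Z: "Z \<in> regular_vecs" "nu_poly Z \<noteq> 0" "P = F Z" using P by (auto simp: D'_def)
  note nd = nondegenerate[OF Z(1,2), folded Z(3)] and s = s_bounds[OF Z(1)]
  define \<zeta> where "\<zeta> = of_real (cos_phase P) - \<i> * of_real (\<epsilon> * sqrt (1 - (cos_phase P)\<^sup>2))"
  have Re: "Re \<zeta> = cos_phase P" and Im: "Im \<zeta> = - \<epsilon> * sqrt (1 - (cos_phase P)\<^sup>2)" by (simp_all add: \<zeta>_def)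
  have "\<epsilon>\<^sup>2 = 1" using \<epsilon> by auto
  then have "(cmod \<zeta>)\<^sup>2 = 1"
    unfolding cmod_power2 Re Im using nd(3) by (simp add: power_mult_distrib)
  then have \<zeta>: "cmod \<zeta> = 1" by (simp add: power2_eq_1_iff) (metis norm_ge_zero neg_0_le_iff_le not_one_le_zero)
  have sec: "sec \<epsilon> P = canonical_vec (s_inv Z) (alpha Z) (beta Z) \<zeta>"
    unfolding sec_def \<zeta>_def Z(3) rec_F[OF Z(1)] ..
  note I = canonical_vec_invariants[OF s less_imp_le[OF nd(1)] less_imp_le[OF nd(2)] \<zeta>]
  \<comment> \<open>The strict bounds make all four coordinates nonzero.\<close>
  have "\<bar>alpha Z\<bar> < 1" "\<bar>beta Z\<bar> < 1" using nd(1,2) by (simp_all add: abs_square_less_1)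
  then show "sec \<epsilon> P \<in> regular_vecs" unfolding regular_vecs_iff sec canonical_vec_def using \<zeta> s by auto
  show "F (sec \<epsilon> P) = P"
    unfolding F_def sec I(3-6) Re nd(4)[symmetric] by (simp add: Z(3) F_def)
  have "nu_poly (sec \<epsilon> P) = \<epsilon> * (s_inv Z * (1 - s_inv Z) / 4 * (sqrt (1 - (alpha Z)\<^sup>2) * sqrt (1 - (beta Z)\<^sup>2)) * sqrt (1 - (cos_phase P)\<^sup>2))"
    unfolding sec I(7) Im by simp
  moreover have "0 < s_inv Z * (1 - s_inv Z) / 4 * (sqrt (1 - (alpha Z)\<^sup>2) * sqrt (1 - (beta Z)\<^sup>2)) * sqrt (1 - (cos_phase P)\<^sup>2)"
    using s nd(1-3) by simp
  ultimately show "sgn (nu_poly (sec \<epsilon> P)) = \<epsilon>" using \<epsilon> by (auto simp: sgn_mult)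
qed

text \<open>The denominators are built from k, m, k^2 - m^2, s, 1 - s and the square roots of 1 -
  a^2 and 1 - b^2, none of which vanishes on \<open>D'\<close>.\<close>

private lemma continuous_on_sec: "continuous_on D' (sec \<epsilon>)"
proof -
  have D: "\<exists>Z\<in>regular_vecs. P = F Z \<and> nu_poly Z \<noteq> 0" if "P \<in> D'" for P using that by (auto simp: D'_def)
  have s01: "0 < rec_s k m P" "rec_s k m P < 1" if P: "P \<in> D'" for P
    using D[OF P] s_bounds rec_F(1) by auto
  have a1: "(rec_a k m P)\<^sup>2 < 1" "(rec_b k m P)\<^sup>2 < 1" if P: "P \<in> D'" for P
    using D[OF P] nondegenerate rec_F by auto
  have N: "continuous_on D' N_minus" "continuous_on D' N_plus"
    unfolding N_minus_def N_plus_def by (intro continuous_intros; simp)+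
  have s: "continuous_on D' (rec_s k m)"
    unfolding rec_s_def by (intro continuous_intros N) (use km'(3) in simp_all)
  have c: "continuous_on D' (rec_c k m)"
    unfolding rec_c_def by (intro continuous_intros N s) (use km'(1,2) s01 in fastforce)
  have d: "continuous_on D' (rec_d k m)"
    unfolding rec_d_def diff_norm2_def by (intro continuous_intros c) (use km'(3) in simp_all)
  have a: "continuous_on D' (rec_a k m)" and b: "continuous_on D' (rec_b k m)"
    unfolding rec_a_def rec_b_def by (intro continuous_intros s d; use km'(1,2) in simp)+
  have "continuous_on D' cos_phase"
    unfolding cos_phase_def by (intro continuous_intros a b c) (use a1 in fastforce)
  then show ?thesis
    unfolding sec_def canonical_vec_def by (intro continuous_on_vec4 continuous_intros s a b) simp_all
qed

private lemma sheet_iff: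
  assumes "Z \<in> regular_vecs" shows "pi_F Z \<in> sheet \<epsilon> \<longleftrightarrow> sgn (nu_poly Z) = \<epsilon>"
  unfolding sheet_def using assms by (auto dest: pi_F_invariants(5))

private lemma openin_sheet:
  assumes "\<epsilon> = 1 \<or> \<epsilon> = - 1" shows "openin M_F (sheet \<epsilon>)"
proof -
  have "{Z \<in> regular_vecs. pi_F Z \<in> sheet \<epsilon>} = regular_vecs \<inter> {Z. \<epsilon> * nu_poly Z > 0}"
    using assms sheet_iff by (auto simp: sgn_if split: if_splits)
  moreover have "open {Z. \<epsilon> * nu_poly Z > 0}"
    unfolding nu_poly_def by (intro open_Collect_less continuous_intros)
  ultimately show ?thesis
    using openin_M_F[of "sheet \<epsilon>"] by (auto simp: sheet_def openin_open)
qed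

private lemma homeo_sheet:
  assumes \<epsilon>: "\<epsilon> = 1 \<or> \<epsilon> = - 1"
  shows "homeomorphic_map (subtopology M_F (sheet \<epsilon>)) (top_of_set D') (p_map (xi k m))"
  unfolding homeomorphic_map_maps
proof (intro exI[of _ "pi_F \<circ> sec \<epsilon>"], unfold homeomorphic_maps_def, intro conjI ballI)
  have sub: "sheet \<epsilon> \<subseteq> pi_F ` regular_vecs" by (auto simp: sheet_def)
  then have top: "topspace (subtopology M_F (sheet \<epsilon>)) = sheet \<epsilon>" by (auto simp: topspace_M_F)
  have p_in: "p_map (xi k m) X \<in> D'" if "X \<in> sheet \<epsilon>" for X
    using that \<epsilon> by (auto simp: sheet_def D'_def p_pi_F)
  show "continuous_map (subtopology M_F (sheet \<epsilon>)) (top_of_set D') (p_map (xi k m))"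
    using continuous_map_from_subtopology[OF continuous_p] p_in
    by (auto simp: continuous_map_in_subtopology top)
  have "continuous_map (top_of_set D') (top_of_set regular_vecs) (sec \<epsilon>)"
    using continuous_on_sec sec_works(1)[OF _ \<epsilon>] by auto
  then have "continuous_map (top_of_set D') M_F (pi_F \<circ> sec \<epsilon>)"
    using quotient_imp_continuous_map[OF quotient_map_pi_F] continuous_map_compose by blast
  then show "continuous_map (top_of_set D') (subtopology M_F (sheet \<epsilon>)) (pi_F \<circ> sec \<epsilon>)"
    using sec_works[OF _ \<epsilon>] by (auto simp: continuous_map_in_subtopology sheet_iff)
  show "p_map (xi k m) ((pi_F \<circ> sec \<epsilon>) P) = P" if "P \<in> topspace (top_of_set D')" for P
    using that sec_works[OF _ \<epsilon>] by (simp add: p_pi_F)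
  show "(pi_F \<circ> sec \<epsilon>) (p_map (xi k m) X) = X" if "X \<in> topspace (subtopology M_F (sheet \<epsilon>))" for X
  proof -
    have X: "X \<in> sheet \<epsilon>" using that top by simp
    then obtain Z where Z: "Z \<in> regular_vecs" "X = pi_F Z" "sgn (nu_poly Z) = \<epsilon>" by (auto simp: sheet_def)
    let ?W = "sec \<epsilon> (F Z)"
    have P: "F Z \<in> D'" using p_in[OF X] Z by (simp add: p_pi_F)
    note W = sec_works[OF P \<epsilon>]
    \<comment> \<open>By \<open>F_eqD\<close> there are two candidates for the orbit; the sign of
      \<open>nu_poly\<close> excludes the conjugate one.\<close>
    have "pi_F ?W \<noteq> pi_F (conj_vec Z)"
    proof
      assume "pi_F ?W = pi_F (conj_vec Z)"
      then have "sgn (nu_poly ?W) = sgn (nu_poly (conj_vec Z))" by (rule pi_F_invariants)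
      then show False using W(3) Z(3) \<epsilon> by (auto simp: nu_poly_conj_vec sgn_minus)
    qed
    then have "pi_F ?W = pi_F Z" using F_eqD[OF Z(1) W(1,2)] by blast
    then show ?thesis by (simp add: Z(1,2) p_pi_F)
  qed
qed

section \<open>Fibres and the covering off the branch locus\<close>

private lemma fibre_card:
  assumes "Z \<in> regular_vecs"
  shows "{X \<in> topspace M_F. p_map (xi k m) X = p_map (xi k m) (pi_F Z)} = {pi_F Z, pi_F (conj_vec Z)}"
proof (intro equalityI subsetI)
  fix X assume X: "X \<in> {X \<in> topspace M_F. p_map (xi k m) X = p_map (xi k m) (pi_F Z)}"
  then obtain W where "W \<in> regular_vecs" "X = pi_F W" unfolding topspace_M_F by blast
  with X show "X \<in> {pi_F Z, pi_F (conj_vec Z)}"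
    using F_eqD[OF assms] assms by (simp add: p_pi_F)
next
  fix X assume "X \<in> {pi_F Z, pi_F (conj_vec Z)}"
  then show "X \<in> {X \<in> topspace M_F. p_map (xi k m) X = p_map (xi k m) (pi_F Z)}"
    using assms invariants_conj_vec(5)[of Z] p_pi_F F_conj_vec unfolding topspace_M_F by force
qed

private lemma branch_complement: "topspace M_F - branch_set = pi_F ` {Z \<in> regular_vecs. nu_poly Z \<noteq> 0}"
  unfolding topspace_M_F using pi_F_in_branch by auto

private lemma image_complement: "p_map (xi k m) ` (topspace M_F - branch_set) = D'"
  unfolding branch_complement D'_def image_image by (rule image_cong) (auto simp: p_pi_F)

private lemma double_covering_complement:
  "double_covering (subtopology M_F (topspace M_F - branch_set)) (top_of_set D') (p_map (xi k m))"
proof -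
  let ?p = "p_map (xi k m)" and ?X = "subtopology M_F (topspace M_F - branch_set)"
  have topX: "topspace ?X = topspace M_F - branch_set" by auto
  have cov: "sheet 1 \<union> sheet (-1) = topspace M_F - branch_set"
    unfolding branch_complement sheet_def by (auto simp: sgn_if)
  have sub: "subtopology ?X (sheet \<epsilon>) = subtopology M_F (sheet \<epsilon>)" if "\<epsilon> = 1 \<or> \<epsilon> = -1" for \<epsilon>
    using that cov by (auto simp: subtopology_subtopology intro!: arg_cong[of _ _ "subtopology M_F"])
  have op: "openin ?X (sheet \<epsilon>)" if "\<epsilon> = 1 \<or> \<epsilon> = -1" for \<epsilon>
    unfolding openin_subtopology
    by (intro exI[of _ "sheet \<epsilon>"]) (use openin_sheet[OF that] that cov in auto)
  have disj: "disjnt (sheet 1) (sheet (-1))"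
    unfolding disjnt_def using sheet_iff by (auto simp: sheet_def[of 1])
  \<comment> \<open>Disjoint sheets differ only if they are not both empty; a point of
    \<open>D'\<close> provides an element through its section.\<close>
  have ne: "sheet 1 \<noteq> sheet (-1)" if "P \<in> D'" for P
  proof -
    have "pi_F (sec 1 P) \<in> sheet 1" using sec_works[OF that] by (simp add: sheet_iff)
    then show ?thesis using disj by (auto simp: disjnt_iff)
  qed
  have "continuous_map ?X (top_of_set D') ?p"
    using continuous_map_from_subtopology[OF continuous_p] image_complement
    by (auto simp: continuous_map_in_subtopology topX)
  moreover have "\<exists>V. P \<in> V \<and> openin (top_of_set D') V \<and>
        (\<exists>\<U>. card \<U> = 2 \<and> \<Union>\<U> = {x \<in> topspace ?X. ?p x \<in> V} \<and>
             (\<forall>U\<in>\<U>. openin ?X U) \<and> pairwise disjnt \<U> \<and>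
             (\<forall>U\<in>\<U>. homeomorphic_map (subtopology ?X U) (subtopology (top_of_set D') V) ?p))"
    if P: "P \<in> D'" for P
  \<comment> \<open>The whole base is evenly covered, so it serves as the neighbourhood of every
    point.\<close>
  proof (intro exI[of _ D'] exI[of _ "{sheet 1, sheet (-1)}"] conjI)
    show "card {sheet 1, sheet (- 1)} = 2" using ne[OF P] by simp
    show "\<Union> {sheet 1, sheet (- 1)} = {x \<in> topspace ?X. ?p x \<in> D'}"
      using cov image_complement unfolding topX by auto
    show "pairwise disjnt {sheet 1, sheet (- 1)}"
      using disj by (auto simp: pairwise_insert disjnt_sym)
    show "\<forall>U\<in>{sheet 1, sheet (- 1)}. homeomorphic_map (subtopology ?X U) (subtopology (top_of_set D') D') ?p"
      using homeo_sheet sub by (simp add: subtopology_subtopology)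
  qed (use P op in auto)
  ultimately show ?thesis
    unfolding double_covering_def topX image_complement by simp
qed

lemma branched_double_cover_p:
  "bounded (p_map (xi k m) ` topspace M_F) \<and>
   branched_double_cover M_F (top_of_set (p_map (xi k m) ` topspace M_F)) (p_map (xi k m)) branch_set \<and>
   (\<forall>x\<in>topspace M_F. \<forall>y\<in>topspace M_F. x \<noteq> y \<and> p_map (xi k m) x = p_map (xi k m) y \<longrightarrow>
      delta_F x = y \<and> delta_F y = x)"
proof (intro conjI)
  let ?p = "p_map (xi k m)"
  show "bounded (?p ` topspace M_F)" unfolding image_p by (rule bounded_F)
  show "branched_double_cover M_F (top_of_set (?p ` topspace M_F)) ?p branch_set"
    unfolding branched_double_cover_def
  proof (intro conjI ballI)
    show "continuous_map M_F (top_of_set (?p ` topspace M_F)) ?p"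
      using continuous_p by (auto simp: continuous_map_in_subtopology)
    show "branch_set \<subseteq> topspace M_F" by (auto simp: branch_set_eq topspace_M_F)
    show "card {x' \<in> topspace M_F. ?p x' = ?p x} = (if x \<in> branch_set then 1 else 2)"
      if x: "x \<in> topspace M_F" for x
    proof -
      obtain Z where Z: "Z \<in> regular_vecs" "x = pi_F Z" using x unfolding topspace_M_F by blast
      show ?thesis unfolding Z(2) fibre_card[OF Z(1)] pi_F_in_branch[OF Z(1)]
        using pi_F_conj_vec_eq_iff[OF Z(1)] card_2_iff[of "{pi_F Z, pi_F (conj_vec Z)}"] by (cases "nu_poly Z = 0") (simp, metis)
    qed
    have "D' \<subseteq> ?p ` topspace M_F" unfolding image_p D'_def by auto
    then have "subtopology (top_of_set (?p ` topspace M_F)) D' = top_of_set D'"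
      by (simp add: subtopology_subtopology Int_absorb1)
    then show "double_covering (subtopology M_F (topspace M_F - branch_set))
        (subtopology (top_of_set (?p ` topspace M_F)) (?p ` (topspace M_F - branch_set))) ?p"
      unfolding image_complement using double_covering_complement by simp
  qed simp
  show "\<forall>x\<in>topspace M_F. \<forall>y\<in>topspace M_F. x \<noteq> y \<and> ?p x = ?p y \<longrightarrow> delta_F x = y \<and> delta_F y = x"
  proof (intro ballI impI)
    fix x y assume xy: "x \<in> topspace M_F" "y \<in> topspace M_F" "x \<noteq> y \<and> ?p x = ?p y"
    obtain Z where Z: "Z \<in> regular_vecs" "x = pi_F Z" using xy unfolding topspace_M_F by blast
    have "y \<in> {pi_F Z, pi_F (conj_vec Z)}" using xy unfolding fibre_card[OF Z(1), symmetric] Z(2) by simp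
    then have "y = pi_F (conj_vec Z)" using xy Z by auto
    then show "delta_F x = y \<and> delta_F y = x" by (simp add: Z(2) delta_pi_F)
  qed
qed

end

theorem theorem6p10:
  fixes k m :: int
  assumes "k \<noteq> 0" and "m \<noteq> 0" and "k \<noteq> m" and "k \<noteq> - m"
  defines "p \<equiv> p_map (xi k m)"
  defines "D \<equiv> p ` topspace M_F"
  shows "bounded D \<and>
         branched_double_cover M_F (top_of_set D) p branch_set \<and>
         (\<forall>x\<in>topspace M_F. \<forall>y\<in>topspace M_F. x \<noteq> y \<and> p x = p y \<longrightarrow>
            delta_F x = y \<and> delta_F y = x)"
  unfolding D_def p_def by (rule branched_double_cover_p) (fact assms)+

end
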